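(* Let $G=GL(m|n)$ over a field $K$ of characteristic $p>2$ and let $\Gamma$ be an arbitrary ideal of $X(T)^+$. Let $\pi_\Gamma:Dist(G)\to S_\Gamma$ be the superalgebra morphism $\xi\mapsto\xi|_{C_\Gamma}$. Then the image $\pi_\Gamma(Dist(G))$ is dense in $S_\Gamma$ (in the pseudocompact topology).
   Context: $K$ is a field of characteristic $p>2$, $G=GL(m|n)$ with coordinate Hopf superalgebra $K[G]$; left $G$-supermodules are right $K[G]$-supercomodules, $\rho_r$ is the structure on $K[G]$ given by $\Delta_G$. $X(T)=\mathbb Z^{m+n}$ with basis $\epsilon_i$; $X(T)^+$ is the set of dominant weights ($\lambda_1\ge\dots\ge\lambda_m$, $\lambda_{m+1}\ge\dots\ge\lambda_{m+n}$), ordered by $\mu\unlhd\lambda$ iff $\lambda-\mu$ is a nonnegative integer combination of $\epsilon_i-\epsilon_j$, $i<j$; an ideal is a down-closed subset. $L_-(\lambda)$ is the simple socle of $H^0_-(\lambda)=\mathrm{ind}^G_{B^-}K_\lambda$ ($B^-$ lower triangular Borel); irreducible $G$-supermodules are $L_-(\lambda)$, $\Pi L_-(\lambda)$ ($\Pi$ parity shift). $C_\Gamma=O_\Gamma(K[G])$ is the largest subsupermodule of $(K[G],\rho_r)$ all of whose composition factors are $L_-(\lambda)$ or $\Pi L_-(\lambda)$ with $\lambda\in\Gamma$; it is a subsupercoalgebra. $S_\Gamma=C_\Gamma^*$ is the generalized Schur superalgebra, with product $\phi\psi(c)=\sum(-1)^{|\psi||c_1|}\phi(c_1)\psi(c_2)$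 and topology with basis of neighborhoods of zero $D^\perp=\{\phi\mid\phi(D)=0\}$ for finite-dimensional subsupercoalgebras $D\subseteq C_\Gamma$. $Dist(G)=\bigcup_{t\ge0}(K[G]/\mathfrak m^{t+1})^*\subseteq K[G]^*$, $\mathfrak m=\ker\epsilon_G$, with the same product formula. *)

theory Defs
  imports
    "HOL-Library.Poly_Mapping"
    "HOL-Library.Nat_Bijection"
    "HOL-Computational_Algebra.Fraction_Field"
    "HOL-Combinatorics.Permutations"
    "HOL-Algebra.Module"
    "HOL-Analysis.Abstract_Topology"
begin

section \<open>Grassmann algebras\<close>

text \<open>The Grassmann algebra over a commutative ring on generators \<open>\<xi>\<^sub>0, \<xi>\<^sub>1, \<dots>\<close>. An element is
  given by its coefficients with respect to the basis \<open>\<xi>\<^sub>S = \<xi>\<^sub>s\<^sub>1 \<cdots> \<xi>\<^sub>s\<^sub>k\<close>, where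
  \<open>S = {s\<^sub>1 < \<dots> < s\<^sub>k}\<close> is a finite set of natural numbers.\<close>

typedef (overloaded) 'a grassmann =
  "{f :: nat set \<Rightarrow> 'a::zero. finite {S. f S \<noteq> 0} \<and> (\<forall>S. f S \<noteq> 0 \<longrightarrow> finite S)}"
  morphisms gcoeff Abs_grassmann
  by (rule exI[of _ "\<lambda>_. 0"]) simp

setup_lifting type_definition_grassmann

lemma grassmann_eqI: "(\<And>S. finite S \<Longrightarrow> gcoeff x S = gcoeff y S) \<Longrightarrow> x = y"
  by transfer (metis (no_types, lifting) ext mem_Collect_eq)

lemma gcoeff_infinite [simp]: "infinite S \<Longrightarrow> gcoeff x S = 0"
  by transfer auto

lemma finite_gcoeff: "finite {S. gcoeff x S \<noteq> 0}"
  by transfer auto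

text \<open>\<open>\<xi>\<^sub>S \<xi>\<^sub>T = shuffle_sign S T \<xi>\<^sub>S\<^sub>\<union>\<^sub>T\<close> for disjoint \<open>S\<close> and \<open>T\<close>.\<close>

definition shuffle_sign :: "nat set \<Rightarrow> nat set \<Rightarrow> 'a::comm_ring_1"
  where "shuffle_sign S T = (- 1) ^ card {(s, t). s \<in> S \<and> t \<in> T \<and> t < s}"

lemma finite_inversions: "finite S \<Longrightarrow> finite T \<Longrightarrow> finite {(s, t). s \<in> S \<and> t \<in> T \<and> t < (s::nat)}"
  by (rule finite_subset[of _ "S \<times> T"]) auto

lemma shuffle_sign_Un_left:
  assumes "finite S" "finite S'" "finite T" "S \<inter> S' = {}"
  shows "shuffle_sign (S \<union> S') T = shuffle_sign S T * shuffle_sign S' T"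
proof -
  have "{(s, t). s \<in> S \<union> S' \<and> t \<in> T \<and> t < s} =
      {(s, t). s \<in> S \<and> t \<in> T \<and> t < s} \<union> {(s, t). s \<in> S' \<and> t \<in> T \<and> t < s}" by auto
  then show ?thesis
    unfolding shuffle_sign_def power_add[symmetric]
    by (subst card_Un_disjoint[symmetric]) (use assms in \<open>auto simp: finite_inversions\<close>)
qed

lemma shuffle_sign_Un_right:
  assumes "finite S" "finite T" "finite T'" "T \<inter> T' = {}"
  shows "shuffle_sign S (T \<union> T') = shuffle_sign S T * shuffle_sign S T'"
proof -
  have "{(s, t). s \<in> S \<and> t \<in> T \<union> T' \<and> t < s} =
      {(s, t). s \<in> S \<and> t \<in> T \<and> t < s} \<union> {(s, t). s \<in> S \<and> t \<in> T' \<and> t < s}" by auto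
  then show ?thesis
    unfolding shuffle_sign_def power_add[symmetric]
    by (subst card_Un_disjoint[symmetric]) (use assms in \<open>auto simp: finite_inversions\<close>)
qed

lemma shuffle_sign_empty [simp]: "shuffle_sign {} T = 1" "shuffle_sign S {} = 1"
  by (simp_all add: shuffle_sign_def)

instantiation grassmann :: (comm_ring_1) ring_1
begin

lift_definition zero_grassmann :: "'a grassmann" is "\<lambda>_. 0" by simp

lift_definition one_grassmann :: "'a grassmann" is "\<lambda>S. if S = {} then 1 else 0" by simp

lift_definition plus_grassmann :: "'a grassmann \<Rightarrow> 'a grassmann \<Rightarrow> 'a grassmann"
  is "\<lambda>f g S. f S + g S"
proof -
  fix f g :: "nat set \<Rightarrow> 'a"
  assume "finite {S. f S \<noteq> 0} \<and> (\<forall>S. f S \<noteq> 0 \<longrightarrow> finite S)"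
    "finite {S. g S \<noteq> 0} \<and> (\<forall>S. g S \<noteq> 0 \<longrightarrow> finite S)"
  then show "finite {S. f S + g S \<noteq> 0} \<and> (\<forall>S. f S + g S \<noteq> 0 \<longrightarrow> finite S)"
    by (auto intro: finite_subset[of _ "{S. f S \<noteq> 0} \<union> {S. g S \<noteq> 0}"])
       (metis add.right_neutral)
qed

lift_definition uminus_grassmann :: "'a grassmann \<Rightarrow> 'a grassmann" is "\<lambda>f S. - f S" by simp

definition minus_grassmann :: "'a grassmann \<Rightarrow> 'a grassmann \<Rightarrow> 'a grassmann"
  where "minus_grassmann x y = x + - y"

lift_definition times_grassmann :: "'a grassmann \<Rightarrow> 'a grassmann \<Rightarrow> 'a grassmann"
  is "\<lambda>f g U. \<Sum>S\<in>Pow U. shuffle_sign S (U - S) * f S * g (U - S)"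
proof -
  fix f g :: "nat set \<Rightarrow> 'a"
  assume f: "finite {S. f S \<noteq> 0} \<and> (\<forall>S. f S \<noteq> 0 \<longrightarrow> finite S)"
    and g: "finite {S. g S \<noteq> 0} \<and> (\<forall>S. g S \<noteq> 0 \<longrightarrow> finite S)"
  let ?h = "\<lambda>U. \<Sum>S\<in>Pow U. shuffle_sign S (U - S) * f S * g (U - S)"
  have *: "\<exists>S T. f S \<noteq> 0 \<and> g T \<noteq> 0 \<and> U = S \<union> T" if U: "?h U \<noteq> 0" for U
  proof -
    obtain S where "S \<in> Pow U" "shuffle_sign S (U - S) * f S * g (U - S) \<noteq> 0"
      using U by (meson sum.neutral)
    then have "f S \<noteq> 0" "g (U - S) \<noteq> 0" "U = S \<union> (U - S)" by auto
    then show ?thesis by blast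
  qed
  have "{U. ?h U \<noteq> 0} \<subseteq> (\<lambda>(S, T). S \<union> T) ` ({S. f S \<noteq> 0} \<times> {T. g T \<noteq> 0})"
    using * by fast
  then have "finite {U. ?h U \<noteq> 0}"
    by (rule finite_subset) (use f g in auto)
  moreover have "finite U" if "?h U \<noteq> 0" for U
    using *[OF that] f g by auto
  ultimately show "finite {U. ?h U \<noteq> 0} \<and> (\<forall>U. ?h U \<noteq> 0 \<longrightarrow> finite U)" by blast
qed

instance
proof
  fix x y z :: "'a grassmann"
  show "x + y + z = x + (y + z)" by transfer (simp add: add.assoc)
  show "x + y = y + x" by transfer (simp add: add.commute)
  show "0 + x = x" by transfer simp
  show "- x + x = 0" by transfer simp
  show "x - y = x + - y" by (rule minus_grassmann_def)
  show "(0::'a grassmann) \<noteq> 1" by transfer (metis zero_neq_one)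
  show "(x + y) * z = x * z + y * z"
    by transfer (simp add: algebra_simps sum.distrib)
  show "x * (y + z) = x * y + x * z"
    by transfer (simp add: algebra_simps sum.distrib)
  show "1 * x = x"
  proof (rule grassmann_eqI)
    fix U :: "nat set" assume U: "finite U"
    show "gcoeff (1 * x) U = gcoeff x U"
      unfolding times_grassmann.rep_eq one_grassmann.rep_eq
      by (subst sum.remove[of _ "{}"]) (use U in \<open>auto intro!: sum.neutral\<close>)
  qed
  show "x * 1 = x"
  proof (rule grassmann_eqI)
    fix U :: "nat set" assume U: "finite U"
    have "(\<Sum>S\<in>Pow U - {U}. shuffle_sign S (U - S) * gcoeff x S * (if U - S = {} then 1 else 0)) = 0"
      by (intro sum.neutral) auto
    then show "gcoeff (x * 1) U = gcoeff x U"
      unfolding times_grassmann.rep_eq one_grassmann.rep_eq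
      by (subst sum.remove[of _ U]) (use U in auto)
  qed
  show "x * y * z = x * (y * z)"
  proof (rule grassmann_eqI)
    fix U :: "nat set" assume U: "finite U"
    have fin: "finite A" if "A \<subseteq> U" for A using U that finite_subset by blast
    let ?s = "shuffle_sign :: nat set \<Rightarrow> nat set \<Rightarrow> 'a"
    have "gcoeff (x * y * z) U = (\<Sum>V\<in>Pow U. \<Sum>A\<in>Pow V. ?s V (U - V) * (?s A (V - A) *
        gcoeff x A * gcoeff y (V - A)) * gcoeff z (U - V))"
      by (simp add: times_grassmann.rep_eq sum_distrib_left sum_distrib_right)
    also have "\<dots> = (\<Sum>(V, A)\<in>Sigma (Pow U) Pow. ?s V (U - V) * (?s A (V - A) *
        gcoeff x A * gcoeff y (V - A)) * gcoeff z (U - V))"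
      by (subst sum.Sigma) (use U fin in auto)
    also have "\<dots> = (\<Sum>(A, B)\<in>Sigma (Pow U) (\<lambda>A. Pow (U - A)). ?s A (U - A) * gcoeff x A *
        (?s B (U - A - B) * gcoeff y B * gcoeff z (U - A - B)))"
    proof (rule sum.reindex_bij_witness[where i = "\<lambda>(A, B). (A \<union> B, A)"
          and j = "\<lambda>(V, A). (A, V - A)"], goal_cases)
      case (5 p)
      then obtain V A where p: "p = (V, A)" and VA: "V \<subseteq> U" "A \<subseteq> V" by auto
      define B C where "B = V - A" and "C = U - V"
      have *: "V = A \<union> B" "U - A = B \<union> C" "U - A - B = C" "U - V = C" "V - A = B"
        "A \<inter> B = {}" "B \<inter> C = {}" "finite A" "finite B" "finite C"
        using VA fin unfolding B_def C_def by auto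
      have d: "U - A - (V - A) = C" using * by simp
      have "?s A (U - A) * gcoeff x A * (?s (V - A) (U - A - (V - A)) * gcoeff y (V - A) *
          gcoeff z (U - A - (V - A))) = ?s V (U - V) * (?s A (V - A) * gcoeff x A *
          gcoeff y (V - A)) * gcoeff z (U - V)"
        unfolding d \<open>V - A = B\<close> \<open>U - V = C\<close> \<open>U - A = B \<union> C\<close>
        unfolding \<open>V = A \<union> B\<close>
        using * by (simp add: shuffle_sign_Un_left shuffle_sign_Un_right)
      then show ?case by (simp add: p)
    qed auto
    also have "\<dots> = (\<Sum>A\<in>Pow U. \<Sum>B\<in>Pow (U - A). ?s A (U - A) * gcoeff x A *
        (?s B (U - A - B) * gcoeff y B * gcoeff z (U - A - B)))"
      by (subst sum.Sigma) (use U in auto)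
    also have "\<dots> = gcoeff (x * (y * z)) U"
      by (simp add: times_grassmann.rep_eq sum_distrib_left)
    finally show "gcoeff (x * y * z) U = gcoeff (x * (y * z)) U" .
  qed
qed

end

lift_definition base :: "'a::comm_ring_1 \<Rightarrow> 'a grassmann" is "\<lambda>r S. if S = {} then r else 0"
  by simp

lift_definition odd_var :: "nat \<Rightarrow> 'a::comm_ring_1 grassmann" is "\<lambda>v S. if S = {v} then 1 else 0"
  by simp

lift_definition part :: "bool \<Rightarrow> 'a::comm_ring_1 grassmann \<Rightarrow> 'a grassmann"
  is "\<lambda>p f S. if odd (card S) = p then f S else 0"
  by (auto elim: rev_finite_subset)

lemma base_mult: "base a * base b = base (a * b)"
proof (rule grassmann_eqI)
  fix U :: "nat set" assume U: "finite U"
  show "gcoeff (base a * base b) U = gcoeff (base (a * b)) U"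
    unfolding times_grassmann.rep_eq base.rep_eq
    by (subst sum.remove[of _ "{}"]) (use U in \<open>auto intro!: sum.neutral\<close>)
qed

lemma base_add: "base (a + b) = base a + base b"
  by transfer auto

lemma base_one: "base 1 = 1"
  by transfer auto


section \<open>The coordinate superalgebra\<close>

text \<open>All superalgebras below are realised inside one ambient supercommutative superalgebra, the
  Grassmann algebra over a field of rational functions. Its even and odd indeterminates are numbered
  so that for every pair of indices \<open>i\<close>, \<open>j\<close> there are countably many copies of the \<open>(i, j)\<close> matrix
  entry: copy 0 is used for the functions on \<open>G\<close>, copies 1 and 2 for the functions on \<open>G \<times> G\<close>.\<close>

type_synonym 'k ratfun = "((nat \<Rightarrow>\<^sub>0 nat) \<Rightarrow>\<^sub>0 'k) fract"
type_synonym 'k superfun = "'k ratfun grassmann"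

definition ratfun_const :: "'k::field \<Rightarrow> 'k ratfun"
  where "ratfun_const c = Fraction_Field.Fract (Poly_Mapping.single 0 c) 1"

definition ratfun_var :: "nat \<Rightarrow> 'k::field ratfun"
  where "ratfun_var v = Fraction_Field.Fract (Poly_Mapping.single (Poly_Mapping.single v 1) 1) 1"

definition scal :: "'k::field \<Rightarrow> 'k superfun \<Rightarrow> 'k superfun"
  where "scal c x = base (ratfun_const c) * x"

lemma ratfun_const_add: "ratfun_const (a + b) = ratfun_const a + ratfun_const b"
  by (simp add: ratfun_const_def Poly_Mapping.single_add)

lemma ratfun_const_mult: "ratfun_const (a * b) = ratfun_const a * ratfun_const b"
  by (simp add: ratfun_const_def Poly_Mapping.mult_single)

lemma ratfun_const_one: "ratfun_const 1 = 1"
  by (simp add: ratfun_const_def One_fract_def)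

global_interpretation superfun: vector_space scal
  by unfold_locales
    (simp_all add: scal_def distrib_left distrib_right ratfun_const_add base_add ratfun_const_mult
      base_mult[symmetric] mult.assoc ratfun_const_one base_one)

definition var_index :: "nat \<Rightarrow> nat \<Rightarrow> nat \<Rightarrow> nat"
  where "var_index s i j = prod_encode (s, prod_encode (i, j))"

text \<open>Matrix indices run through \<open>{..<m+n}\<close>; those below \<open>m\<close> are even, the others are odd.
  The entry \<open>gen m s i j\<close> has parity \<open>\<bar>i\<bar> + \<bar>j\<bar>\<close>.\<close>

definition gen :: "nat \<Rightarrow> nat \<Rightarrow> nat \<Rightarrow> nat \<Rightarrow> 'k::field superfun"
  where "gen m s i j = (if (i < m) = (j < m) then base (ratfun_var (var_index s i j))
                        else odd_var (var_index s i j))"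

definition block_det :: "nat set \<Rightarrow> 'k::field ratfun"
  where "block_det I = (\<Sum>\<sigma> | \<sigma> permutes I. of_int (sign \<sigma>) * (\<Prod>i\<in>I. ratfun_var (var_index 0 i (\<sigma> i))))"

text \<open>\<open>K[G]\<close> for \<open>G = GL(m|n)\<close>: the localisation of the free supercommutative superalgebra on the
  entries \<open>c\<^sub>i\<^sub>j\<close> of a generic supermatrix at the determinants of its two diagonal blocks.\<close>

inductive_set coord_alg :: "nat \<Rightarrow> nat \<Rightarrow> 'k::field superfun set" for m n where
  const: "scal c 1 \<in> coord_alg m n"
| gen: "i < m + n \<Longrightarrow> j < m + n \<Longrightarrow> gen m 0 i j \<in> coord_alg m n"
| inv_det_even: "base (inverse (block_det {..<m})) \<in> coord_alg m n"
| inv_det_odd: "base (inverse (block_det {m..<m + n})) \<in> coord_alg m n"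
| add: "a \<in> coord_alg m n \<Longrightarrow> b \<in> coord_alg m n \<Longrightarrow> a + b \<in> coord_alg m n"
| mult: "a \<in> coord_alg m n \<Longrightarrow> b \<in> coord_alg m n \<Longrightarrow> a * b \<in> coord_alg m n"

text \<open>By the universal property of \<open>K[G]\<close>, a superalgebra morphism from \<open>K[G]\<close> to a superalgebra
  (whose scalars are given by \<open>emb\<close>) exists and is uniquely determined by the images \<open>y i j\<close> of the
  generators, provided that \<open>y\<close> is an invertible even supermatrix with supercommuting entries.\<close>

definition is_alg_hom :: "nat \<Rightarrow> nat \<Rightarrow> ('k::field \<Rightarrow> 'b::ring_1) \<Rightarrow> ('k superfun \<Rightarrow> 'b) \<Rightarrow> bool"
  where "is_alg_hom m n emb F \<longleftrightarrow>
    (\<forall>c. F (scal c 1) = emb c) \<and>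
    (\<forall>a\<in>coord_alg m n. \<forall>b\<in>coord_alg m n. F (a + b) = F a + F b \<and> F (a * b) = F a * F b)"

definition coord_hom ::
    "nat \<Rightarrow> nat \<Rightarrow> ('k::field \<Rightarrow> 'b::ring_1) \<Rightarrow> (nat \<Rightarrow> nat \<Rightarrow> 'b) \<Rightarrow> 'k superfun \<Rightarrow> 'b"
  where "coord_hom m n emb y =
    (THE F. F \<in> extensional (coord_alg m n) \<and> is_alg_hom m n emb F \<and>
      (\<forall>i<m + n. \<forall>j<m + n. F (gen m 0 i j) = y i j))"

text \<open>\<open>K[G] \<otimes> K[G]\<close> (the graded tensor product) is realised as the superalgebra of functions on
  \<open>G \<times> G\<close>, that is, by two supercommuting copies of \<open>K[G]\<close>.\<close>

definition copy :: "nat \<Rightarrow> nat \<Rightarrow> nat \<Rightarrow> 'k::field superfun \<Rightarrow> 'k superfun"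
  where "copy m n s = coord_hom m n (\<lambda>c. scal c 1) (gen m s)"

definition tens :: "nat \<Rightarrow> nat \<Rightarrow> 'k::field superfun \<Rightarrow> 'k superfun \<Rightarrow> 'k superfun"
  where "tens m n a b = copy m n 1 a * copy m n 2 b"

definition tensor_space ::
    "nat \<Rightarrow> nat \<Rightarrow> 'k::field superfun set \<Rightarrow> 'k superfun set \<Rightarrow> 'k superfun set"
  where "tensor_space m n V W = superfun.span {tens m n v w | v w. v \<in> V \<and> w \<in> W}"

definition comult :: "nat \<Rightarrow> nat \<Rightarrow> 'k::field superfun \<Rightarrow> 'k superfun"
  where "comult m n = coord_hom m n (\<lambda>c. scal c 1) (\<lambda>i j. \<Sum>k<m + n. gen m 1 i k * gen m 2 k j)"

definition counit :: "nat \<Rightarrow> nat \<Rightarrow> 'k::field superfun \<Rightarrow> 'k"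
  where "counit m n = coord_hom m n (\<lambda>c. c) (\<lambda>i j. if i = j then 1 else 0)"


section \<open>Subsupermodules and subsupercoalgebras\<close>

definition subsuperspace :: "'k::field superfun set \<Rightarrow> bool"
  where "subsuperspace V \<longleftrightarrow> superfun.subspace V \<and> (\<forall>x\<in>V. \<forall>p. part p x \<in> V)"

definition subsupermodule :: "nat \<Rightarrow> nat \<Rightarrow> 'k::field superfun set \<Rightarrow> bool"
  where "subsupermodule m n V \<longleftrightarrow> V \<subseteq> coord_alg m n \<and> subsuperspace V \<and>
    (\<forall>x\<in>V. comult m n x \<in> tensor_space m n V (coord_alg m n))"

definition subsupercoalgebra :: "nat \<Rightarrow> nat \<Rightarrow> 'k::field superfun set \<Rightarrow> bool"
  where "subsupercoalgebra m n D \<longleftrightarrow> D \<subseteq> coord_alg m n \<and> subsuperspace D \<and>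
    (\<forall>x\<in>D. comult m n x \<in> tensor_space m n D D)"

definition finite_dim :: "'k::field superfun set \<Rightarrow> bool"
  where "finite_dim V \<longleftrightarrow> (\<exists>B. finite B \<and> V = superfun.span B)"

text \<open>The quotient \<open>X/Y\<close> is an irreducible supermodule; for \<open>Y = {0}\<close>, so is \<open>X\<close>.\<close>

definition irreducible_factor ::
    "nat \<Rightarrow> nat \<Rightarrow> 'k::field superfun set \<Rightarrow> 'k superfun set \<Rightarrow> bool"
  where "irreducible_factor m n X Y \<longleftrightarrow> subsupermodule m n X \<and> subsupermodule m n Y \<and> Y \<subset> X \<and>
    (\<forall>Z. subsupermodule m n Z \<and> Y \<subseteq> Z \<and> Z \<subseteq> X \<longrightarrow> Z = Y \<or> Z = X)"

definition socle :: "nat \<Rightarrow> nat \<Rightarrow> 'k::field superfun set \<Rightarrow> 'k superfun set"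
  where "socle m n V = superfun.span (\<Union>{S. irreducible_factor m n S {0} \<and> S \<subseteq> V})"

definition linear_on :: "'k::field superfun set \<Rightarrow> ('k \<Rightarrow> 'b \<Rightarrow> 'b) \<Rightarrow> ('k superfun \<Rightarrow> 'b::ab_group_add) \<Rightarrow> bool"
  where "linear_on V sc f \<longleftrightarrow> (\<forall>x\<in>V. \<forall>y\<in>V. f (x + y) = f x + f y) \<and> (\<forall>c. \<forall>x\<in>V. f (scal c x) = sc c (f x))"

text \<open>\<open>f\<close> induces an isomorphism of \<open>X/Y\<close> onto \<open>L\<close> (for \<open>p = False\<close>) or onto \<open>\<Pi> L\<close> (for \<open>p = True\<close>):
  it is a surjective linear map of parity \<open>p\<close> with kernel \<open>Y\<close> and \<open>(f \<otimes> id) \<circ> \<Delta> = \<Delta> \<circ> f\<close>.\<close>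

definition quotient_iso :: "nat \<Rightarrow> nat \<Rightarrow> bool \<Rightarrow> 'k::field superfun set \<Rightarrow> 'k superfun set \<Rightarrow>
    'k superfun set \<Rightarrow> ('k superfun \<Rightarrow> 'k superfun) \<Rightarrow> bool"
  where "quotient_iso m n p X Y L f \<longleftrightarrow>
    linear_on X scal f \<and> f ` X = L \<and> {x \<in> X. f x = 0} = Y \<and>
    (\<forall>x\<in>X. \<forall>q. f (part q x) = part (q \<noteq> p) (f x)) \<and>
    (\<forall>x\<in>X. \<exists>N u a. (\<forall>i<N::nat. u i \<in> X \<and> a i \<in> coord_alg m n) \<and>
      comult m n x = (\<Sum>i<N. tens m n (u i) (a i)) \<and>
      comult m n (f x) = (\<Sum>i<N. tens m n (f (u i)) (a i)))"


section \<open>Weights and induced supermodules\<close>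

text \<open>A weight \<open>\<Sum>\<nu>\<^sub>i \<epsilon>\<^sub>i\<close> is represented by its coefficient function, vanishing outside \<open>{..<m+n}\<close>.\<close>

definition dominant_weights :: "nat \<Rightarrow> nat \<Rightarrow> (nat \<Rightarrow> int) set"
  where "dominant_weights m n = {\<nu>. (\<forall>i\<ge>m + n. \<nu> i = 0) \<and>
    (\<forall>i j. i \<le> j \<and> j < m \<longrightarrow> \<nu> j \<le> \<nu> i) \<and> (\<forall>i j. m \<le> i \<and> i \<le> j \<and> j < m + n \<longrightarrow> \<nu> j \<le> \<nu> i)}"

definition eps :: "nat \<Rightarrow> nat \<Rightarrow> int"
  where "eps i = (\<lambda>k. if k = i then 1 else 0)"

definition weight_le :: "nat \<Rightarrow> nat \<Rightarrow> (nat \<Rightarrow> int) \<Rightarrow> (nat \<Rightarrow> int) \<Rightarrow> bool"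
  where "weight_le m n \<mu> \<nu> \<longleftrightarrow> (\<exists>a :: nat \<Rightarrow> nat \<Rightarrow> nat. \<forall>k.
    \<nu> k - \<mu> k = (\<Sum>j<m + n. \<Sum>i<j. int (a i j) * (eps i k - eps j k)))"

definition weight_ideal :: "nat \<Rightarrow> nat \<Rightarrow> (nat \<Rightarrow> int) set \<Rightarrow> bool"
  where "weight_ideal m n \<Gamma> \<longleftrightarrow> \<Gamma> \<subseteq> dominant_weights m n \<and>
    (\<forall>\<nu>\<in>\<Gamma>. \<forall>\<mu>\<in>dominant_weights m n. weight_le m n \<mu> \<nu> \<longrightarrow> \<mu> \<in> \<Gamma>)"

text \<open>The left coaction \<open>K[G] \<rightarrow> K[B\<^sup>-] \<otimes> K[G]\<close>, that is, the comultiplication followed by the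
  restriction to \<open>B\<^sup>-\<close> (setting \<open>c\<^sub>i\<^sub>j = 0\<close> for \<open>i < j\<close>) in the first factor. The first copy of the
  entries \<open>c\<^sub>i\<^sub>j\<close> with \<open>j \<le> i\<close> serves as the coordinates on \<open>B\<^sup>-\<close>.\<close>

definition borel_coaction :: "nat \<Rightarrow> nat \<Rightarrow> 'k::field superfun \<Rightarrow> 'k superfun"
  where "borel_coaction m n = coord_hom m n (\<lambda>c. scal c 1) (\<lambda>i j. \<Sum>k\<le>i. gen m 1 i k * gen m 2 k j)"

definition borel_character :: "nat \<Rightarrow> nat \<Rightarrow> (nat \<Rightarrow> int) \<Rightarrow> 'k::field superfun"
  where "borel_character m n \<nu> = base (\<Prod>i<m + n. ratfun_var (var_index 1 i i) powi \<nu> i)"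

text \<open>The induced supermodule \<open>ind\<^sup>G K\<^sub>\<nu>\<close> from \<open>B\<^sup>-\<close>, as the cotensor product of \<open>K\<^sub>\<nu>\<close> and \<open>K[G]\<close>
  over \<open>K[B\<^sup>-]\<close>, viewed in \<open>K\<^sub>\<nu> \<otimes> K[G] = K[G]\<close>.\<close>

definition H0_minus :: "nat \<Rightarrow> nat \<Rightarrow> (nat \<Rightarrow> int) \<Rightarrow> 'k::field superfun set"
  where "H0_minus m n \<nu> =
    {f \<in> coord_alg m n. borel_coaction m n f = borel_character m n \<nu> * copy m n 2 f}"

definition L_minus :: "nat \<Rightarrow> nat \<Rightarrow> (nat \<Rightarrow> int) \<Rightarrow> 'k::field superfun set"
  where "L_minus m n \<nu> = socle m n (H0_minus m n \<nu>)"

definition belongs_to :: "nat \<Rightarrow> nat \<Rightarrow> (nat \<Rightarrow> int) set \<Rightarrow> 'k::field superfun set \<Rightarrow> bool"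
  where "belongs_to m n \<Gamma> V \<longleftrightarrow> subsupermodule m n V \<and>
    (\<forall>X Y. irreducible_factor m n X Y \<and> X \<subseteq> V \<longrightarrow>
      (\<exists>\<nu>\<in>\<Gamma>. \<exists>p f. quotient_iso m n p X Y (L_minus m n \<nu>) f))"

text \<open>The largest subsupermodule belonging to \<open>\<Gamma>\<close>, obtained as the sum of all of them.\<close>

definition C_ideal :: "nat \<Rightarrow> nat \<Rightarrow> (nat \<Rightarrow> int) set \<Rightarrow> 'k::field superfun set"
  where "C_ideal m n \<Gamma> = superfun.span (\<Union>{V. belongs_to m n \<Gamma> V})"

lemma C_ideal_eq_greatest:
  assumes "belongs_to m n \<Gamma> C" "\<And>V. belongs_to m n \<Gamma> V \<Longrightarrow> V \<subseteq> C"
  shows "C = C_ideal m n \<Gamma>"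
proof -
  have "\<Union>{V. belongs_to m n \<Gamma> V} = C" using assms by blast
  moreover have "superfun.subspace C"
    using assms(1) by (simp add: belongs_to_def subsupermodule_def subsuperspace_def)
  ultimately show ?thesis unfolding C_ideal_def by (metis superfun.span_eq_iff)
qed


section \<open>The distribution superalgebra and generalized Schur superalgebras\<close>

record ('a, 'b) superalgebra = "('a, 'b) module" +
  component :: "bool \<Rightarrow> 'b set"

definition dual_space :: "'k::field superfun set \<Rightarrow> ('k superfun \<Rightarrow> 'k) set"
  where "dual_space C = {\<phi> \<in> extensional C. linear_on C (*) \<phi>}"

text \<open>\<open>(\<phi>\<psi>)(c) = \<Sum> (-1)\<^bsup>|\<psi>| |c\<^sub>1|\<^esup> \<phi>(c\<^sub>1) \<psi>(c\<^sub>2)\<close> with homogeneous \<open>c\<^sub>1\<close> in \<open>\<Delta>(c) = \<Sum> c\<^sub>1 \<otimes> c\<^sub>2\<close>, extended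
  to inhomogeneous \<open>\<psi> = \<psi>\<^sub>0 + \<psi>\<^sub>1\<close>, where \<open>\<psi>\<^sub>q(x) = \<psi>(x\<^sub>q)\<close>.\<close>

definition convolution :: "nat \<Rightarrow> nat \<Rightarrow> 'k::field superfun set \<Rightarrow>
    ('k superfun \<Rightarrow> 'k) \<Rightarrow> ('k superfun \<Rightarrow> 'k) \<Rightarrow> 'k superfun \<Rightarrow> 'k"
  where "convolution m n C \<phi> \<psi> = (\<lambda>c\<in>C. THE r. \<exists>N u v par.
    (\<forall>i<N::nat. u i \<in> C \<and> v i \<in> C \<and> part (par i) (u i) = u i) \<and>
    comult m n c = (\<Sum>i<N. tens m n (u i) (v i)) \<and>
    r = (\<Sum>i<N. \<Sum>q\<in>UNIV. (if q \<and> par i then - 1 else 1) * \<phi> (u i) * \<psi> (part q (v i))))"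

definition functional_superalgebra :: "nat \<Rightarrow> nat \<Rightarrow> 'k::field superfun set \<Rightarrow>
    ('k superfun \<Rightarrow> 'k) set \<Rightarrow> ('k, 'k superfun \<Rightarrow> 'k) superalgebra"
  where "functional_superalgebra m n C S =
    \<lparr>carrier = S, mult = convolution m n C, one = restrict (counit m n) C,
     zero = (\<lambda>c\<in>C. 0), add = (\<lambda>\<phi> \<psi>. \<lambda>c\<in>C. \<phi> c + \<psi> c), smult = (\<lambda>r \<phi>. \<lambda>c\<in>C. r * \<phi> c),
     component = (\<lambda>p. {\<phi> \<in> S. \<forall>c\<in>C. \<phi> (part (\<not> p) c) = 0})\<rparr>"

definition aug_ideal :: "nat \<Rightarrow> nat \<Rightarrow> 'k::field superfun set"
  where "aug_ideal m n = {a \<in> coord_alg m n. counit m n a = 0}"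

fun aug_power :: "nat \<Rightarrow> nat \<Rightarrow> nat \<Rightarrow> 'k::field superfun set" where
  "aug_power m n 0 = coord_alg m n"
| "aug_power m n (Suc t) = superfun.span {a * b | a b. a \<in> aug_ideal m n \<and> b \<in> aug_power m n t}"

text \<open>A functional on \<open>K[G]/\<mm>\<^bsup>t+1\<^esup>\<close> is a functional on \<open>K[G]\<close> vanishing on \<open>\<mm>\<^bsup>t+1\<^esup>\<close>.\<close>

definition Dist :: "nat \<Rightarrow> nat \<Rightarrow> ('k::field, 'k superfun \<Rightarrow> 'k) superalgebra"
  where "Dist m n = functional_superalgebra m n (coord_alg m n)
    (\<Union>t. {\<xi> \<in> dual_space (coord_alg m n). \<forall>a\<in>aug_power m n (t + 1). \<xi> a = 0})"

definition Schur :: "nat \<Rightarrow> nat \<Rightarrow> (nat \<Rightarrow> int) set \<Rightarrow> ('k::field, 'k superfun \<Rightarrow> 'k) superalgebra"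
  where "Schur m n \<Gamma> = functional_superalgebra m n (C_ideal m n \<Gamma>) (dual_space (C_ideal m n \<Gamma>))"

definition pi_map :: "nat \<Rightarrow> nat \<Rightarrow> (nat \<Rightarrow> int) set \<Rightarrow>
    ('k::field superfun \<Rightarrow> 'k) \<Rightarrow> 'k superfun \<Rightarrow> 'k"
  where "pi_map m n \<Gamma> \<xi> = restrict \<xi> (C_ideal m n \<Gamma>)"

text \<open>Since \<open>D\<^sup>\<bottom> \<inter> D'\<^sup>\<bottom> = (D + D')\<^sup>\<bottom>\<close>, the sets \<open>\<phi> + D\<^sup>\<bottom>\<close> form a base, not merely a subbase, of
  the topology they generate, and the sets \<open>D\<^sup>\<bottom>\<close> a neighbourhood base of zero.\<close>

definition perp :: "nat \<Rightarrow> nat \<Rightarrow> (nat \<Rightarrow> int) set \<Rightarrow> 'k::field superfun set \<Rightarrow> ('k superfun \<Rightarrow> 'k) set"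
  where "perp m n \<Gamma> D = {\<phi> \<in> carrier (Schur m n \<Gamma>). \<forall>d\<in>D. \<phi> d = 0}"

definition Schur_topology :: "nat \<Rightarrow> nat \<Rightarrow> (nat \<Rightarrow> int) set \<Rightarrow> ('k::field superfun \<Rightarrow> 'k) topology"
  where "Schur_topology m n \<Gamma> = topology (arbitrary union_of (finite intersection_of
    (\<lambda>U. \<exists>\<phi>\<in>carrier (Schur m n \<Gamma>). \<exists>D. subsupercoalgebra m n D \<and> finite_dim D \<and> D \<subseteq> C_ideal m n \<Gamma> \<and>
      U = (\<lambda>\<delta>. add (Schur m n \<Gamma>) \<phi> \<delta>) ` perp m n \<Gamma> D)
    relative_to carrier (Schur m n \<Gamma>)))"

end

theory Submission
  imports Defs "HOL-Computational_Algebra.Polynomial"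
begin

text \<open>Density amounts to surjectivity of the restriction \<open>Dist(G) \<rightarrow> D\<^sup>*\<close> for every
  finite-dimensional \<open>D \<subseteq> K[G]\<close>. Since \<open>D\<close> is finite-dimensional, this follows once the powers of
  the augmentation ideal intersect in zero, for then \<open>D\<close> meets some power trivially and functionals on
  \<open>D\<close> extend by zero on that power. For the Krull intersection property, expand the numerator and the
  denominator of a rational function along the rays \<open>e + t x\<close> through the identity matrix \<open>e\<close>; the
  coefficients of an element of the \<open>k\<close>-th power of the augmentation ideal at odd monomials of
  degree \<open>s\<close> vanish at \<open>e\<close> to order at least \<open>k - s\<close>.\<close>

section \<open>Substitution in polynomials\<close>

type_synonym 'k mpol = "(nat \<Rightarrow>\<^sub>0 nat) \<Rightarrow>\<^sub>0 'k"

text \<open>\<open>ratfun_var v\<close> is the fraction with numerator \<open>mvar v\<close> and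
  denominator 1; \<open>mconst\<close> below is related to \<open>ratfun_const\<close> in the same
  way.\<close>

definition mvar :: "nat \<Rightarrow> 'k::comm_ring_1 mpol"
  where "mvar v = Poly_Mapping.single (Poly_Mapping.single v 1) 1"

definition mconst :: "'k::comm_ring_1 \<Rightarrow> 'k mpol"
  where "mconst c = Poly_Mapping.single 0 c"

definition unital_hom :: "('a::comm_ring_1 \<Rightarrow> 'b::comm_ring_1) \<Rightarrow> bool"
  where "unital_hom h \<longleftrightarrow> h 1 = 1 \<and> (\<forall>x y. h (x + y) = h x + h y \<and> h (x * y) = h x * h y)"

lemma unital_homD:
  assumes "unital_hom h"
  shows "h 0 = 0" "h 1 = 1" "h (x + y) = h x + h y" "h (x * y) = h x * h y"
proof -
  have "h (0 + 0) = h 0 + h 0" using assms unfolding unital_hom_def by blast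
  then show "h 0 = 0" by simp
qed (use assms in \<open>auto simp: unital_hom_def\<close>)

lemma unital_hom_minus:
  assumes "unital_hom h"
  shows "h (- x) = - h x"
proof -
  have "h (x + - x) = h x + h (- x)" using assms by (rule unital_homD)
  then show ?thesis using unital_homD(1)[OF assms] by (simp add: eq_neg_iff_add_eq_0 add.commute)
qed

lemma unital_hom_sum: "unital_hom h \<Longrightarrow> h (sum f A) = (\<Sum>a\<in>A. h (f a))"
  by (induction A rule: infinite_finite_induct) (simp_all add: unital_homD)

lemma unital_hom_prod: "unital_hom h \<Longrightarrow> h (prod f A) = (\<Prod>a\<in>A. h (f a))"
  by (induction A rule: infinite_finite_induct) (simp_all add: unital_homD)

lemma unital_hom_of_nat: "unital_hom h \<Longrightarrow> h (of_nat k) = of_nat k"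
  by (induction k) (simp_all add: unital_homD)

lemma unital_hom_of_int: "unital_hom h \<Longrightarrow> h (of_int k) = of_int k"
  by (cases k rule: int_cases2) (simp_all add: unital_hom_minus unital_hom_of_nat)

lemma unital_hom_comp: "unital_hom g \<Longrightarrow> unital_hom h \<Longrightarrow> unital_hom (\<lambda>x. g (h x))"
  by (simp add: unital_hom_def)

lemma unital_hom_id: "unital_hom (\<lambda>x. x)"
  by (simp add: unital_hom_def)

lemma unital_hom_mconst: "unital_hom mconst"
  by (simp add: unital_hom_def mconst_def Poly_Mapping.single_add Poly_Mapping.mult_single)

lemma unital_hom_pCons: "unital_hom (\<lambda>a. [:a:])"
  by (simp add: unital_hom_def pCons_one)

lemma unital_hom_poly: "unital_hom (\<lambda>p. poly p a)"
  by (simp add: unital_hom_def)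

section \<open>Generation of the polynomial ring by constants and variables\<close>

lemma poly_mapping_sum_induct:
  fixes p :: "'a \<Rightarrow>\<^sub>0 'b::comm_monoid_add"
  assumes single: "\<And>a c. P (Poly_Mapping.single a c)"
    and add: "\<And>p q. P p \<Longrightarrow> P q \<Longrightarrow> P (p + q)"
  shows "P p"
proof -
  have eq: "p = (\<Sum>a\<in>Poly_Mapping.keys p. Poly_Mapping.single a (Poly_Mapping.lookup p a))"
    by (rule poly_mapping_eqI)
      (auto simp: lookup_sum lookup_single when_def not_in_keys_iff_lookup_eq_zero)
  have "P (\<Sum>a\<in>A. Poly_Mapping.single a (Poly_Mapping.lookup p a))" if "finite A" for A
    \<comment> \<open>The empty sum is 0, which \<open>single\<close> covers as coefficient 0 at an
      arbitrary key.\<close>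
    using that by (induction A) (use single[of undefined 0] in \<open>auto intro: single add\<close>)
  then show ?thesis by (subst eq) simp
qed

lemma mpol_induct:
  fixes p :: "'k::comm_ring_1 mpol"
  assumes const: "\<And>c. P (mconst c)" and var: "\<And>v. P (mvar v)"
    and add: "\<And>p q. P p \<Longrightarrow> P q \<Longrightarrow> P (p + q)" and mult: "\<And>p q. P p \<Longrightarrow> P q \<Longrightarrow> P (p * q)"
  shows "P p"
proof (rule poly_mapping_sum_induct)
  have var_power: "P (Poly_Mapping.single (Poly_Mapping.single v k) 1)" for v k
  proof (induction k)
    case 0
    show ?case using const[of 1] by (simp add: mconst_def)
  next
    case (Suc k)
    have "Poly_Mapping.single (Poly_Mapping.single v (Suc k)) (1::'k) =
        mvar v * Poly_Mapping.single (Poly_Mapping.single v k) 1"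
      by (simp add: mvar_def Poly_Mapping.mult_single flip: Poly_Mapping.single_add)
    then show ?case using mult[OF var Suc] by simp
  qed
  \<comment> \<open>Exponent vectors are themselves finitely supported maps, so the same induction
    applies to them; adding exponents multiplies monomials.\<close>
  have monomial: "P (Poly_Mapping.single a 1)" for a
  proof (rule poly_mapping_sum_induct[of "\<lambda>a. P (Poly_Mapping.single a 1)"])
    fix a b :: "nat \<Rightarrow>\<^sub>0 nat"
    assume "P (Poly_Mapping.single a 1)" "P (Poly_Mapping.single b 1)"
    from mult[OF this] show "P (Poly_Mapping.single (a + b) 1)"
      by (simp add: Poly_Mapping.mult_single)
  qed (rule var_power)
  show "P (Poly_Mapping.single a c)" for a c
    using mult[OF const[of c] monomial[of a]] by (simp add: mconst_def Poly_Mapping.mult_single)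
qed (rule add)

lemma unital_hom_eqI:
  assumes "unital_hom g" "unital_hom h"
    and "\<And>c. g (mconst c) = h (mconst c)" "\<And>v. g (mvar v) = h (mvar v)"
  shows "g p = h p"
  by (induction p rule: mpol_induct) (use assms in \<open>auto simp: unital_homD\<close>)

section \<open>Evaluation homomorphisms\<close>

definition monom_value :: "(nat \<Rightarrow> 'b::comm_ring_1) \<Rightarrow> (nat \<Rightarrow>\<^sub>0 nat) \<Rightarrow> 'b"
  where "monom_value f a = (\<Prod>v\<in>Poly_Mapping.keys a. f v ^ Poly_Mapping.lookup a v)"

text \<open>Coefficients may change ring along \<open>h\<close>, so that evaluation at a point,
  expansion along rays and translation of the variables are all instances.\<close>

definition insertion :: "('k::comm_ring_1 \<Rightarrow> 'b::comm_ring_1) \<Rightarrow> (nat \<Rightarrow> 'b) \<Rightarrow> 'k mpol \<Rightarrow> 'b"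
  where "insertion h f p = (\<Sum>a\<in>Poly_Mapping.keys p. h (Poly_Mapping.lookup p a) * monom_value f a)"

text \<open>Keys outside the support contribute \<open>f v ^ 0 = 1\<close>, so one index set can
  serve several exponent vectors at once.\<close>

lemma monom_value_superset:
  "finite A \<Longrightarrow> Poly_Mapping.keys a \<subseteq> A \<Longrightarrow> monom_value f a = (\<Prod>v\<in>A. f v ^ Poly_Mapping.lookup a v)"
  unfolding monom_value_def
  by (rule prod.mono_neutral_left) (auto simp: not_in_keys_iff_lookup_eq_zero)

lemma monom_value_add: "monom_value f (a + b) = monom_value f a * monom_value f b"
proof -
  let ?A = "Poly_Mapping.keys a \<union> Poly_Mapping.keys b"
  have "Poly_Mapping.keys (a + b) \<subseteq> ?A" by (rule keys_add)
  then show ?thesis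
    by (simp add: monom_value_superset[of ?A] lookup_add power_add prod.distrib)
qed

lemma insertion_superset:
  assumes "unital_hom h" "finite A" "Poly_Mapping.keys p \<subseteq> A"
  shows "insertion h f p = (\<Sum>a\<in>A. h (Poly_Mapping.lookup p a) * monom_value f a)"
  unfolding insertion_def
  by (rule sum.mono_neutral_left)
    (use assms in \<open>auto simp: not_in_keys_iff_lookup_eq_zero unital_homD\<close>)

lemma insertion_single:
  "unital_hom h \<Longrightarrow> insertion h f (Poly_Mapping.single a c) = h c * monom_value f a"
  by (subst insertion_superset[of _ "{a}"]) auto

lemma insertion_add:
  assumes "unital_hom h"
  shows "insertion h f (p + q) = insertion h f p + insertion h f q"
proof -
  let ?A = "Poly_Mapping.keys p \<union> Poly_Mapping.keys q"
  have "Poly_Mapping.keys (p + q) \<subseteq> ?A" by (rule keys_add)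
  then show ?thesis using assms
    by (simp add: insertion_superset[of _ ?A] lookup_add unital_homD distrib_right sum.distrib)
qed

text \<open>Multiplicativity is additive in each factor and so reduces to single terms, where it is
  \<open>monom_value_add\<close>.\<close>

lemma unital_hom_insertion:
  assumes h: "unital_hom h"
  shows "unital_hom (insertion h f)"
proof -
  have "insertion h f (p * q) = insertion h f p * insertion h f q" for p q
  proof (induction p rule: poly_mapping_sum_induct)
    case (1 a c)
    show ?case
    proof (induction q rule: poly_mapping_sum_induct)
      case (1 b d)
      then show ?case
        by (simp add: Poly_Mapping.mult_single insertion_single h monom_value_add unital_homD ac_simps)
    qed (simp add: distrib_left insertion_add[OF h])
  qed (simp add: distrib_right insertion_add[OF h])
  moreover have "insertion h f 1 = 1"
    using insertion_single[OF h, of f 0 1] by (simp add: unital_homD[OF h] monom_value_def)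
  ultimately show ?thesis by (simp add: unital_hom_def insertion_add[OF h])
qed

lemma insertion_mconst: "unital_hom h \<Longrightarrow> insertion h f (mconst c) = h c"
  by (simp add: mconst_def insertion_single monom_value_def)

lemma insertion_mvar: "unital_hom h \<Longrightarrow> insertion h f (mvar v) = f v"
  by (simp add: mvar_def insertion_single monom_value_def unital_homD)

section \<open>Order of vanishing at the identity matrix\<close>

text \<open>The coordinates of the identity matrix, in the numbering of indeterminates by \<open>var_index\<close>.\<close>

definition unit_entry :: "nat \<Rightarrow> 'k::comm_ring_1"
  where "unit_entry v = (case prod_decode (snd (prod_decode v)) of (i, j) \<Rightarrow> if i = j then 1 else 0)"

lemma unit_entry_var_index: "unit_entry (var_index s i j) = (if i = j then 1 else 0)"
  by (simp add: unit_entry_def var_index_def)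

definition eval_unit :: "'k::comm_ring_1 mpol \<Rightarrow> 'k"
  where "eval_unit = insertion (\<lambda>c. c) unit_entry"

text \<open>The outer polynomial variable is the time t. The coefficient of t^k is the homogeneous
  part of degree k in the Taylor expansion of the polynomial at e.\<close>

definition ray :: "'k::comm_ring_1 mpol \<Rightarrow> 'k mpol poly"
  where "ray = insertion (\<lambda>c. [:mconst c:]) (\<lambda>v. [:mconst (unit_entry v), mvar v:])"

lemmas unital_hom_ray_const = unital_hom_comp[OF unital_hom_pCons unital_hom_mconst]

lemma unital_hom_eval_unit: "unital_hom eval_unit"
  unfolding eval_unit_def by (intro unital_hom_insertion unital_hom_id)

lemma unital_hom_ray: "unital_hom ray"
  unfolding ray_def by (intro unital_hom_insertion unital_hom_ray_const)

lemmas eval_unit_simps = unital_homD[OF unital_hom_eval_unit]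
lemmas ray_simps = unital_homD[OF unital_hom_ray]

lemma eval_unit_mconst [simp]: "eval_unit (mconst c) = c"
  by (simp add: eval_unit_def insertion_mconst unital_hom_id)

lemma eval_unit_mvar [simp]: "eval_unit (mvar v) = unit_entry v"
  by (simp add: eval_unit_def insertion_mvar unital_hom_id)

lemma ray_mconst [simp]: "ray (mconst c) = [:mconst c:]"
  by (simp add: ray_def insertion_mconst unital_hom_ray_const)

lemma ray_mvar [simp]: "ray (mvar v) = [:mconst (unit_entry v), mvar v:]"
  by (simp add: ray_def insertion_mvar unital_hom_ray_const)

text \<open>At time 0 every ray is at e. Both sides are homomorphisms, so comparing them on
  constants and variables suffices.\<close>

lemma poly_ray_0: "poly (ray p) 0 = mconst (eval_unit p)"
  by (rule unital_hom_eqI[of "\<lambda>p. poly (ray p) 0" "\<lambda>p. mconst (eval_unit p)"])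
    (auto intro: unital_hom_comp unital_hom_poly unital_hom_ray unital_hom_mconst unital_hom_eval_unit)

text \<open>At time 1 the ray is the translation by \<open>e\<close>, which is undone by the translation by \<open>-e\<close>.\<close>

lemma ray_eq_0_iff: "ray p = 0 \<longleftrightarrow> p = 0"
proof
  let ?shift = "insertion mconst (\<lambda>v. mvar v + mconst (- unit_entry v))"
  have shift: "unital_hom ?shift" by (intro unital_hom_insertion unital_hom_mconst)
  have mconst_cancel: "mconst x + mconst (- x) = 0" for x :: 'a
    using unital_homD(3)[OF unital_hom_mconst, of x "- x"]
    by (simp add: unital_homD(1)[OF unital_hom_mconst])
  have "?shift (poly (ray p) 1) = p"
    by (rule unital_hom_eqI[of "\<lambda>p. ?shift (poly (ray p) 1)" "\<lambda>p. p"])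
      (auto intro!: unital_hom_comp[OF shift] unital_hom_comp[OF unital_hom_poly unital_hom_ray] unital_hom_id
        simp: unital_homD[OF shift] insertion_mconst insertion_mvar unital_hom_mconst mconst_cancel
          add.left_commute)
  moreover assume "ray p = 0"
  ultimately show "p = 0" by (simp add: unital_homD[OF shift])
qed (simp add: ray_simps)

text \<open>For \<open>k = 0\<close> this is the local ring at e, in general the k-th power of its
  maximal ideal: the order of the numerator at e is the power of t, written \<open>[:0, 1:]\<close>,
  that divides its expansion.\<close>

definition vanishing :: "nat \<Rightarrow> 'k::field ratfun set"
  where "vanishing k = {Fraction_Field.Fract p q | p q. eval_unit q \<noteq> 0 \<and> [:0, 1:] ^ k dvd ray p}"

lemma eval_unit_nonzeroD: "eval_unit q \<noteq> 0 \<Longrightarrow> q \<noteq> 0"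
  by (auto simp: eval_unit_simps)

lemma vanishingI: "eval_unit q \<noteq> 0 \<Longrightarrow> [:0, 1:] ^ k dvd ray p \<Longrightarrow> Fraction_Field.Fract p q \<in> vanishing k"
  unfolding vanishing_def by blast

lemma vanishingE:
  assumes "f \<in> vanishing k"
  obtains p q where "f = Fraction_Field.Fract p q" "eval_unit q \<noteq> 0" "q \<noteq> 0" "[:0, 1:] ^ k dvd ray p"
  using assms eval_unit_nonzeroD unfolding vanishing_def by blast

lemma vanishing_0: "0 \<in> vanishing k"
  unfolding Zero_fract_def by (rule vanishingI) (simp_all add: eval_unit_simps ray_simps)

lemma vanishing_add:
  assumes "f \<in> vanishing k" "g \<in> vanishing k"
  shows "f + g \<in> vanishing k"
proof -
  obtain p q where f: "f = Fraction_Field.Fract p q" "eval_unit q \<noteq> 0" "q \<noteq> 0" "[:0, 1:] ^ k dvd ray p"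
    using assms(1) by (rule vanishingE)
  obtain p' q' where g: "g = Fraction_Field.Fract p' q'" "eval_unit q' \<noteq> 0" "q' \<noteq> 0" "[:0, 1:] ^ k dvd ray p'"
    using assms(2) by (rule vanishingE)
  have "f + g = Fraction_Field.Fract (p * q' + p' * q) (q * q')" using f g by simp
  moreover have "eval_unit (q * q') \<noteq> 0" using f g by (simp add: eval_unit_simps)
  moreover have "[:0, 1:] ^ k dvd ray (p * q' + p' * q)"
    unfolding ray_simps using f g by (intro dvd_add dvd_mult2)
  ultimately show ?thesis by (metis vanishingI)
qed

lemma vanishing_mult:
  assumes "f \<in> vanishing j" "g \<in> vanishing k"
  shows "f * g \<in> vanishing (j + k)"
proof -
  obtain p q where f: "f = Fraction_Field.Fract p q" "eval_unit q \<noteq> 0" "[:0, 1:] ^ j dvd ray p"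
    using assms(1) by (rule vanishingE)
  obtain p' q' where g: "g = Fraction_Field.Fract p' q'" "eval_unit q' \<noteq> 0" "[:0, 1:] ^ k dvd ray p'"
    using assms(2) by (rule vanishingE)
  have "f * g = Fraction_Field.Fract (p * p') (q * q')" using f g by simp
  moreover have "eval_unit (q * q') \<noteq> 0" using f g by (simp add: eval_unit_simps)
  moreover have "[:0, 1:] ^ (j + k) dvd ray (p * p')"
    unfolding ray_simps power_add using f g by (intro mult_dvd_mono)
  ultimately show ?thesis by (metis vanishingI)
qed

lemma vanishing_antimono: "j \<le> k \<Longrightarrow> vanishing k \<subseteq> vanishing j"
  unfolding vanishing_def by (blast intro: dvd_trans le_imp_power_dvd)

lemma vanishing_polynomial: "Fraction_Field.Fract p 1 \<in> vanishing 0"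
  by (rule vanishingI) (simp_all add: eval_unit_simps)

lemma vanishing_const: "ratfun_const c \<in> vanishing 0"
  unfolding ratfun_const_def by (rule vanishing_polynomial)

lemma ratfun_const_0: "ratfun_const 0 = 0"
  by (simp add: ratfun_const_def fract_collapse)

text \<open>A shuffle sign is 1 or -1, hence a constant function and regular at e.\<close>

lemma vanishing_shuffle_sign:
  fixes f :: "'a::field ratfun"
  assumes f: "f \<in> vanishing k"
  shows "shuffle_sign S T * f \<in> vanishing k"
proof -
  have "ratfun_const (- 1 :: 'a) = - ratfun_const 1"
    by (simp add: ratfun_const_def Poly_Mapping.single_uminus)
  moreover have "shuffle_sign S T = (1 :: 'a ratfun) \<or> shuffle_sign S T = (- 1 :: 'a ratfun)"
    unfolding shuffle_sign_def minus_one_power_iff by simp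
  ultimately have "shuffle_sign S T = ratfun_const (1 :: 'a) \<or> shuffle_sign S T = ratfun_const (- 1 :: 'a)"
    by (simp add: ratfun_const_one)
  then have "(shuffle_sign S T :: 'a ratfun) \<in> vanishing 0"
    by (elim disjE) (simp_all only: vanishing_const)
  from vanishing_mult[OF this f] show ?thesis by simp
qed

lemma vanishing_sum: "(\<And>x. x \<in> A \<Longrightarrow> f x \<in> vanishing k) \<Longrightarrow> sum f A \<in> vanishing k"
  by (induction A rule: infinite_finite_induct) (auto intro: vanishing_add vanishing_0)

text \<open>Compare orders in t. Cross-multiplying an arbitrary representation \<open>p / q\<close>
  with one of order \<open>k\<close> shows that t^k divides \<open>ray p * ray q'\<close>; since
  \<open>ray q'\<close> has order 0, this bounds \<open>k\<close> by the order of
  \<open>ray p\<close>.\<close>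

lemma vanishing_all_imp_0:
  assumes "\<And>k. f \<in> vanishing k"
  shows "f = 0"
proof (cases f)
  case (Fract p q)
  \<comment> \<open>Fixed before \<open>p'\<close> and \<open>q'\<close> are obtained, as these
    depend on \<open>k\<close>. The order is meaningful only if \<open>p\<close> is nonzero, and
    only then is it used.\<close>
  define k where "k = Suc (Polynomial.order 0 (ray p))"
  obtain p' q' where f: "f = Fraction_Field.Fract p' q'" "eval_unit q' \<noteq> 0" "q' \<noteq> 0" "[:0, 1:] ^ k dvd ray p'"
    using assms by (rule vanishingE)
  have "p = 0"
  proof (rule ccontr)
    assume "p \<noteq> 0"
    have "p * q' = p' * q" using f Fract by (simp add: eq_fract)
    then have "[:- 0, 1:] ^ k dvd ray p * ray q'" using f by (simp flip: ray_simps(4)) (simp add: ray_simps)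
    moreover have nz: "ray p * ray q' \<noteq> 0" using \<open>p \<noteq> 0\<close> f by (simp add: ray_eq_0_iff)
    ultimately have "k \<le> Polynomial.order 0 (ray p * ray q')" by (simp only: order_divides) simp
    also have "\<dots> = Polynomial.order 0 (ray p) + Polynomial.order 0 (ray q')" using nz by (rule order_mult)
    \<comment> \<open>The constant term of \<open>ray q'\<close> is the value of \<open>q'\<close>
      at e, which is nonzero.\<close>
    also have "order 0 (ray q') = 0"
    proof -
      have "poly (ray q') 0 \<noteq> 0"
        using f(2) eval_unit_mconst[of "eval_unit q'"] by (auto simp: poly_ray_0 eval_unit_simps simp del: eval_unit_mconst)
      then show ?thesis using order_root by blast
    qed
    finally show False by (simp add: k_def)
  qed
  then show ?thesis using Fract by (simp add: fract_collapse)
qed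

text \<open>The residue map of the local ring at e. The choice ranges over the representations whose
  denominator does not vanish at e; on a fraction without such a representation the value is
  unspecified.\<close>

definition value_unit :: "'k::field ratfun \<Rightarrow> 'k"
  where "value_unit f = (SOME r. \<exists>p q. f = Fraction_Field.Fract p q \<and> eval_unit q \<noteq> 0 \<and>
    r = eval_unit p / eval_unit q)"

text \<open>Two representations of one fraction satisfy \<open>p * q' = p' * q\<close>; evaluating
  this identity at e and dividing by the nonzero denominators gives equal quotients.\<close>

lemma value_unit_Fract:
  assumes "eval_unit q \<noteq> 0"
  shows "value_unit (Fraction_Field.Fract p q) = eval_unit p / eval_unit q"
  unfolding value_unit_def
proof (rule some_equality)
  fix r assume "\<exists>p' q'. Fraction_Field.Fract p q = Fraction_Field.Fract p' q' \<and> eval_unit q' \<noteq> 0 \<and>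
    r = eval_unit p' / eval_unit q'"
  then obtain p' q' where eq: "Fraction_Field.Fract p q = Fraction_Field.Fract p' q'"
    "eval_unit q' \<noteq> 0" "r = eval_unit p' / eval_unit q'" by blast
  then have "p * q' = p' * q" using eval_unit_nonzeroD[OF assms] eval_unit_nonzeroD[OF eq(2)] by (simp add: eq_fract)
  then have "eval_unit p * eval_unit q' = eval_unit p' * eval_unit q" by (simp flip: eval_unit_simps)
  then show "r = eval_unit p / eval_unit q" using eq(2,3) assms by (simp add: frac_eq_eq)
qed (use assms in blast)

lemma value_unit_add_mult:
  assumes "f \<in> vanishing 0" "g \<in> vanishing 0"
  shows "value_unit (f + g) = value_unit f + value_unit g"
    and "value_unit (f * g) = value_unit f * value_unit g"
proof -
  obtain p q where f: "f = Fraction_Field.Fract p q" "eval_unit q \<noteq> 0" "q \<noteq> 0"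
    using assms(1) by (rule vanishingE)
  obtain p' q' where g: "g = Fraction_Field.Fract p' q'" "eval_unit q' \<noteq> 0" "q' \<noteq> 0"
    using assms(2) by (rule vanishingE)
  show "value_unit (f + g) = value_unit f + value_unit g"
    using f g by (simp add: value_unit_Fract eval_unit_simps add_frac_eq)
  show "value_unit (f * g) = value_unit f * value_unit g"
    using f g by (simp add: value_unit_Fract eval_unit_simps)
qed

lemma value_unit_const: "value_unit (ratfun_const c) = c"
  using value_unit_Fract[of 1 "mconst c"] by (simp add: ratfun_const_def mconst_def[symmetric] eval_unit_simps)

text \<open>The constant term of \<open>ray p\<close> is the value of the numerator at e, and a
  polynomial in t with zero constant term is divisible by t.\<close>

lemma vanishing_1I:
  assumes "f \<in> vanishing 0" "value_unit f = 0"
  shows "f \<in> vanishing 1"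
proof -
  obtain p q where f: "f = Fraction_Field.Fract p q" "eval_unit q \<noteq> 0"
    using assms(1) by (rule vanishingE)
  then have "poly (ray p) 0 = 0"
    using assms(2) by (simp add: value_unit_Fract poly_ray_0 unital_homD[OF unital_hom_mconst])
  then have "[:0, 1:] ^ 1 dvd ray p" by (simp add: poly_eq_0_iff_dvd)
  then show ?thesis using f by (auto intro: vanishingI)
qed

section \<open>Matrix entries and block determinants at the identity matrix\<close>

lemma ratfun_var_vanishing: "ratfun_var v \<in> vanishing 0"
  unfolding ratfun_var_def by (rule vanishing_polynomial)

lemma Fract_unital_hom: "unital_hom (\<lambda>p. Fraction_Field.Fract p 1)"
  by (simp add: unital_hom_def One_fract_def)

definition block_det_poly :: "nat set \<Rightarrow> 'k::field mpol"
  where "block_det_poly I = (\<Sum>\<sigma> | \<sigma> permutes I. of_int (sign \<sigma>) * (\<Prod>i\<in>I. mvar (var_index 0 i (\<sigma> i))))"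

lemma block_det_eq_Fract: "block_det I = Fraction_Field.Fract (block_det_poly I) 1"
  unfolding block_det_def block_det_poly_def
  by (simp add: unital_hom_sum[OF Fract_unital_hom] unital_homD[OF Fract_unital_hom]
      unital_hom_prod[OF Fract_unital_hom] unital_hom_of_int[OF Fract_unital_hom]
      ratfun_var_def mvar_def del: mult_fract)

text \<open>A permutation other than the identity moves some index of \<open>I\<close>, where it
  meets an off-diagonal entry 0 of e; only the identity term survives.\<close>

lemma eval_unit_block_det_poly:
  assumes "finite I"
  shows "eval_unit (block_det_poly I) = 1"
proof -
  have "eval_unit (block_det_poly I) =
      (\<Sum>\<sigma> | \<sigma> permutes I. of_int (sign \<sigma>) * (\<Prod>i\<in>I. if i = \<sigma> i then 1 else 0 :: 'a))"
    by (simp add: block_det_poly_def unital_hom_sum[OF unital_hom_eval_unit] eval_unit_simps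
      unital_hom_prod[OF unital_hom_eval_unit] unital_hom_of_int[OF unital_hom_eval_unit]
      unit_entry_var_index)
  also have "\<dots> = (\<Sum>\<sigma>\<in>{id}. of_int (sign \<sigma>) * (\<Prod>i\<in>I. if i = \<sigma> i then 1 else 0))"
  proof (rule sum.mono_neutral_right)
    show "\<forall>\<sigma>\<in>{\<sigma>. \<sigma> permutes I} - {id}. of_int (sign \<sigma>) * (\<Prod>i\<in>I. if i = \<sigma> i then 1 else 0 :: 'a) = 0"
    proof
      fix \<sigma> assume "\<sigma> \<in> {\<sigma>. \<sigma> permutes I} - {id}"
      then obtain i where "i \<in> I" "\<sigma> i \<noteq> i" by (auto simp: permutes_def fun_eq_iff)
      then have "(\<Prod>i\<in>I. if i = \<sigma> i then 1 else 0 :: 'a) = 0"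
        using assms by (intro prod_zero bexI[of _ i]) auto
      then show "of_int (sign \<sigma>) * (\<Prod>i\<in>I. if i = \<sigma> i then 1 else 0 :: 'a) = 0" by simp
    qed
  qed (use assms in \<open>auto simp: finite_permutations permutes_id\<close>)
  also have "\<dots> = 1" by (simp add: sign_id)
  finally show ?thesis .
qed

text \<open>A block determinant has value 1 at e and is therefore an admissible denominator.\<close>

lemma inverse_block_det_vanishing: "finite I \<Longrightarrow> inverse (block_det I) \<in> vanishing 0"
  unfolding block_det_eq_Fract inverse_fract by (rule vanishingI) (simp_all add: eval_unit_block_det_poly)

lemma block_det_nonzero: "finite I \<Longrightarrow> block_det I \<noteq> (0 :: 'k::field ratfun)"
  unfolding block_det_eq_Fract
  using eval_unit_nonzeroD[of "block_det_poly I :: 'k mpol"]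
  by (simp add: eval_unit_block_det_poly Zero_fract_def eq_fract)

section \<open>The filtration of the Grassmann algebra\<close>

text \<open>Each odd variable counts as order 1. The subtraction is truncated: once
  \<open>card S\<close> reaches \<open>k\<close>, the coefficient need only be regular at e.\<close>

definition order_filtration :: "nat \<Rightarrow> 'k::field superfun set"
  where "order_filtration k = {x. \<forall>S. gcoeff x S \<in> vanishing (k - card S)}"

lemma gcoeff_scal: "gcoeff (scal c x) U = ratfun_const c * gcoeff x U"
proof (cases "finite U")
  case True
  show ?thesis
    unfolding scal_def times_grassmann.rep_eq base.rep_eq
    by (subst sum.remove[of _ "{}"]) (use True in \<open>auto intro!: sum.neutral\<close>)
qed simp

lemma order_filtration_subspace: "superfun.subspace (order_filtration k)"
proof (rule superfun.subspaceI)
  fix c and x :: "'a superfun" assume "x \<in> order_filtration k"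
  moreover have "ratfun_const c * gcoeff x S \<in> vanishing (k - card S)"
    if "gcoeff x S \<in> vanishing (k - card S)" for S
    using vanishing_mult[OF vanishing_const that] by simp
  ultimately show "scal c x \<in> order_filtration k"
    by (simp add: order_filtration_def gcoeff_scal)
qed (simp_all add: order_filtration_def zero_grassmann.rep_eq plus_grassmann.rep_eq vanishing_0 vanishing_add)

lemma order_filtration_antimono: "j \<le> k \<Longrightarrow> order_filtration k \<subseteq> order_filtration j"
  unfolding order_filtration_def by (blast intro: subsetD[OF vanishing_antimono[OF diff_le_mono]])

lemma order_filtration_mult:
  assumes "x \<in> order_filtration j" "y \<in> order_filtration k"
  shows "x * y \<in> order_filtration (j + k)"
  unfolding order_filtration_def
proof (intro CollectI allI)
  fix U
  show "gcoeff (x * y) U \<in> vanishing (j + k - card U)"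
  proof (cases "finite U")
    case True
    have "shuffle_sign S (U - S) * gcoeff x S * gcoeff y (U - S) \<in> vanishing (j + k - card U)"
      if "S \<subseteq> U" for S
    proof -
      have "gcoeff x S * gcoeff y (U - S) \<in> vanishing ((j - card S) + (k - card (U - S)))"
        using assms unfolding order_filtration_def by (intro vanishing_mult) blast+
      moreover have "card (U - S) = card U - card S" "card S \<le> card U"
        using card_Diff_subset[OF finite_subset[OF that True] that] card_mono[OF True that] by auto
      \<comment> \<open>Each truncated difference is at least the true one, so the sum of the two
        bounds the truncated total from above.\<close>
      then have "j + k - card U \<le> (j - card S) + (k - card (U - S))" by linarith
      ultimately have "gcoeff x S * gcoeff y (U - S) \<in> vanishing (j + k - card U)"
        by (metis vanishing_antimono subsetD)
      then show ?thesis unfolding mult.assoc by (rule vanishing_shuffle_sign)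
    qed
    then show ?thesis unfolding times_grassmann.rep_eq by (intro vanishing_sum) (simp only: Pow_iff)
  next
    case False
    show ?thesis unfolding gcoeff_infinite[OF False] by (rule vanishing_0)
  qed
qed

lemma order_filtration_all_imp_0:
  assumes "\<And>k. x \<in> order_filtration k"
  shows "x = 0"
proof (rule grassmann_eqI)
  fix S
  have "gcoeff x S \<in> vanishing k" for k
  proof -
    \<comment> \<open>Passing to the index \<open>k + card S\<close> compensates for the order
      credited to the odd monomial itself.\<close>
    have "gcoeff x S \<in> vanishing (k + card S - card S)"
      using assms[of "k + card S"] unfolding order_filtration_def by blast
    then show ?thesis by simp
  qed
  then have "gcoeff x S = 0" by (rule vanishing_all_imp_0)
  then show "gcoeff x S = gcoeff 0 S" by (simp add: zero_grassmann.rep_eq)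
qed

lemma base_in_order_filtration: "f \<in> vanishing 0 \<Longrightarrow> base f \<in> order_filtration 0"
  by (auto simp: order_filtration_def base.rep_eq vanishing_0)

lemma gen_in_order_filtration: "gen m s i j \<in> order_filtration 0"
proof (cases "(i < m) = (j < m)")
  case True
  then show ?thesis by (simp add: gen_def base_in_order_filtration ratfun_var_vanishing)
next
  case False
  have "1 \<in> vanishing 0" by (rule vanishing_const[of 1, unfolded ratfun_const_one])
  with False show ?thesis by (simp add: gen_def order_filtration_def odd_var.rep_eq vanishing_0)
qed

text \<open>Index 0 asks only for coefficients regular at e. This holds for the generators and the
  inverse determinants, and survives sums and products.\<close>

lemma coord_alg_subset_order_filtration: "coord_alg m n \<subseteq> order_filtration 0"
proof
  fix x :: "'k::field superfun" assume "x \<in> coord_alg m n"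
  then show "x \<in> order_filtration 0"
  proof induction
    case (const c)
    show ?case by (simp add: scal_def base_in_order_filtration vanishing_const)
  next
    case (mult a b)
    then show ?case using order_filtration_mult[of a 0 b 0] by simp
  next
    case (add a b)
    then show ?case by (intro superfun.subspace_add[OF order_filtration_subspace])
  qed (simp_all add: gen_in_order_filtration base_in_order_filtration inverse_block_det_vanishing)
qed

section \<open>The counit and the powers of its kernel\<close>

lemma base_sum_in:
  assumes "base 0 \<in> A" "\<And>a b. a \<in> A \<Longrightarrow> b \<in> A \<Longrightarrow> a + b \<in> A" "\<And>x. x \<in> I \<Longrightarrow> base (f x) \<in> A"
  shows "base (sum f I) \<in> A"
  using assms(3) by (induction I rule: infinite_finite_induct) (use assms(1,2) in \<open>auto simp: base_add\<close>)

lemma base_prod_in: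
  assumes "base 1 \<in> A" "\<And>a b. a \<in> A \<Longrightarrow> b \<in> A \<Longrightarrow> a * b \<in> A" "\<And>x. x \<in> I \<Longrightarrow> base (f x) \<in> A"
  shows "base (prod f I) \<in> A"
  using assms(3) by (induction I rule: infinite_finite_induct)
    (use assms(1,2) in \<open>auto simp flip: base_mult\<close>)

text \<open>A determinant is a polynomial expression in its entries. \<open>A\<close> is left
  abstract in order to be instantiated with the set on which two homomorphisms agree.\<close>

lemma base_block_det_in:
  assumes const: "\<And>c. scal c 1 \<in> A"
    and add: "\<And>a b. a \<in> A \<Longrightarrow> b \<in> A \<Longrightarrow> a + b \<in> A" and mult: "\<And>a b. a \<in> A \<Longrightarrow> b \<in> A \<Longrightarrow> a * b \<in> A"
    and gen: "\<And>i j. i \<in> I \<Longrightarrow> j \<in> I \<Longrightarrow> base (ratfun_var (var_index 0 i j)) \<in> A"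
  shows "base (block_det I) \<in> A"
proof -
  have const': "base (ratfun_const c) \<in> A" for c using const[of c] by (simp add: scal_def)
  have "base 0 \<in> A" "base 1 \<in> A"
    using const'[of 0] const'[of 1] by (simp_all only: ratfun_const_0 ratfun_const_one)
  moreover have "base (of_int k) \<in> A" for k
  proof -
    \<comment> \<open>The sign is an integer of the function field; it comes from the ground field,
      so the hypothesis on scalars applies.\<close>
    have "(of_int k :: 'a ratfun) = ratfun_const (of_int k)"
    proof -
      have "Fraction_Field.Fract (mconst (of_int k)) 1 = (of_int k :: 'a ratfun)"
        by (rule unital_hom_of_int[OF unital_hom_comp[OF Fract_unital_hom unital_hom_mconst]])
      then show ?thesis by (simp add: ratfun_const_def mconst_def)
    qed
    then show ?thesis by (simp add: const')
  qed
  ultimately have "base (of_int (sign \<sigma>) * (\<Prod>i\<in>I. ratfun_var (var_index 0 i (\<sigma> i)))) \<in> A"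
    if "\<sigma> permutes I" for \<sigma>
    unfolding base_mult[symmetric] using that
    by (intro mult[OF _ base_prod_in] gen mult) (simp_all add: permutes_in_image)
  then show ?thesis unfolding block_det_def using \<open>base 0 \<in> A\<close>
    by (intro base_sum_in) (simp_all only: add mem_Collect_eq)
qed

text \<open>An algebra homomorphism is determined on the inverse determinants by its values on the
  determinants, because inverses in the target field are unique.\<close>

lemma is_alg_hom_unique:
  fixes F F' :: "'k::field superfun \<Rightarrow> 'k"
  assumes F: "is_alg_hom m n (\<lambda>c. c) F" and F': "is_alg_hom m n (\<lambda>c. c) F'"
    and gens: "\<And>i j. i < m + n \<Longrightarrow> j < m + n \<Longrightarrow> F (gen m 0 i j) = F' (gen m 0 i j)"
    and "x \<in> coord_alg m n"
  shows "F x = F' x"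
proof -
  define E where "E = {a \<in> coord_alg m n. F a = F' a}"
  have E_const: "scal c 1 \<in> E" for c
    using F F' by (auto simp: E_def is_alg_hom_def intro: coord_alg.const)
  have E_add: "a + b \<in> E" and E_mult: "a * b \<in> E" if "a \<in> E" "b \<in> E" for a b
    using that F F' by (auto simp: E_def is_alg_hom_def intro: coord_alg.add coord_alg.mult)
  have E_gen: "gen m 0 i j \<in> E" if "i < m + n" "j < m + n" for i j
    using that gens by (auto simp: E_def intro: coord_alg.gen)
  have inv: "F (base (inverse (block_det I))) = F' (base (inverse (block_det I)))"
    if I: "I = {..<m} \<or> I = {m..<m + n}" for I
  proof -
    let ?d = "base (block_det I) :: 'k superfun" and ?e = "base (inverse (block_det I)) :: 'k superfun"
    \<comment> \<open>Both indices lie in the same diagonal block, so the entry is even and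
      \<open>gen\<close> takes its \<open>base\<close> form.\<close>
    have "base (ratfun_var (var_index 0 i j)) \<in> E" if "i \<in> I" "j \<in> I" for i j
      using E_gen[of i j] that I by (auto simp: gen_def)
    then have d: "?d \<in> E" using E_const E_add E_mult by (intro base_block_det_in)
    have e: "?e \<in> coord_alg m n"
      using I by (auto intro: coord_alg.inv_det_even coord_alg.inv_det_odd)
    have "block_det I * inverse (block_det I) = (1 :: 'k ratfun)"
      using I by (intro right_inverse block_det_nonzero) auto
    then have "?d * ?e = scal 1 1" by (simp add: base_mult base_one)
    moreover have "F (?d * ?e) = F ?d * F ?e" "F' (?d * ?e) = F' ?d * F' ?e"
      using F F' d e unfolding is_alg_hom_def E_def by blast+
    moreover have "F (scal 1 1) = 1" "F' (scal 1 1) = 1"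
      using F F' unfolding is_alg_hom_def by blast+
    ultimately have "F ?d * F ?e = 1" "F' ?d * F' ?e = 1" by argo+
    moreover have "F ?d = F' ?d" using d by (simp add: E_def)
    ultimately show ?thesis by (metis inverse_unique)
  qed
  have "x \<in> E" using assms(4)
  proof induction
    case inv_det_even
    show ?case using inv[of "{..<m}"] by (auto simp: E_def intro: coord_alg.inv_det_even)
  next
    case inv_det_odd
    show ?case using inv[of "{m..<m + n}"] by (auto simp: E_def intro: coord_alg.inv_det_odd)
  qed (auto intro: E_const E_gen E_add E_mult)
  then show ?thesis by (simp add: E_def)
qed

text \<open>\<open>counit\<close> is a definite description, so its values become accessible only
  through an explicit homomorphism with the prescribed values on generators, together with
  uniqueness. Killing the odd variables and evaluating at e is such a homomorphism.\<close>

lemma counit_eq_value_unit: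
  fixes x :: "'k::field superfun"
  assumes "x \<in> coord_alg m n"
  shows "counit m n x = value_unit (gcoeff x {})"
proof -
  \<comment> \<open>The restriction makes \<open>F\<close> extensional, as the description
    requires.\<close>
  define F :: "'k superfun \<Rightarrow> 'k" where "F = (\<lambda>x\<in>coord_alg m n. value_unit (gcoeff x {}))"
  have van: "gcoeff a {} \<in> vanishing 0" if "a \<in> coord_alg m n" for a :: "'k superfun"
    using coord_alg_subset_order_filtration that by (fastforce simp: order_filtration_def)
  have hom: "is_alg_hom m n (\<lambda>c. c) F"
    unfolding is_alg_hom_def
  proof (intro conjI allI ballI)
    fix c :: 'k
    show "F (scal c 1) = c"
      by (simp add: F_def coord_alg.const gcoeff_scal one_grassmann.rep_eq value_unit_const)
  next
    fix a b :: "'k superfun" assume ab: "a \<in> coord_alg m n" "b \<in> coord_alg m n"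
    then show "F (a + b) = F a + F b"
      by (simp add: F_def coord_alg.add plus_grassmann.rep_eq van value_unit_add_mult)
    show "F (a * b) = F a * F b"
      using ab by (simp add: F_def coord_alg.mult times_grassmann.rep_eq van value_unit_add_mult)
  qed
  have value_var: "value_unit (ratfun_var v) = (unit_entry v :: 'k)" for v
    using value_unit_Fract[of 1 "mvar v :: 'k mpol"]
    unfolding ratfun_var_def mvar_def[symmetric] by (simp add: eval_unit_simps)
  have value_0: "value_unit 0 = 0"
    by (rule value_unit_const[of 0, unfolded ratfun_const_0])
  have gens: "F (gen m 0 i j) = (if i = j then 1 else 0)" if "i < m + n" "j < m + n" for i j
  proof -
    have "F (gen m 0 i j) = value_unit (gcoeff (gen m 0 i j) {})"
      by (simp add: F_def coord_alg.gen[OF that])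
    also have "\<dots> = (if i = j then 1 else 0)"
      by (simp add: gen_def base.rep_eq odd_var.rep_eq value_var unit_entry_var_index value_0)
    finally show ?thesis .
  qed
  have "counit m n = F"
    unfolding counit_def coord_hom_def
  proof (rule the_equality)
    show "F \<in> extensional (coord_alg m n) \<and> is_alg_hom m n (\<lambda>c. c) F \<and>
        (\<forall>i<m + n. \<forall>j<m + n. F (gen m 0 i j) = (if i = j then 1 else 0))"
      using hom gens by (auto simp: F_def)
  next
    fix F' :: "'k superfun \<Rightarrow> 'k"
    assume F': "F' \<in> extensional (coord_alg m n) \<and> is_alg_hom m n (\<lambda>c. c) F' \<and>
        (\<forall>i<m + n. \<forall>j<m + n. F' (gen m 0 i j) = (if i = j then 1 else 0))"
    show "F' = F"
    proof (rule extensionalityI)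
      show "F' \<in> extensional (coord_alg m n)" using F' by blast
      show "F \<in> extensional (coord_alg m n)" by (simp add: F_def)
      have F'_hom: "is_alg_hom m n (\<lambda>c. c) F'" using F' by blast
      show "F' x = F x" if "x \<in> coord_alg m n" for x
        using is_alg_hom_unique[OF F'_hom hom _ that] F' gens by simp
    qed
  qed
  then show ?thesis using assms by (simp add: F_def)
qed

text \<open>Only the coefficient at \<open>{}\<close> has to vanish at e, and its value there is the
  counit; for finite nonempty \<open>S\<close> the required order \<open>1 - card S\<close> is
  0.\<close>

lemma aug_ideal_subset_order_filtration: "aug_ideal m n \<subseteq> order_filtration 1"
proof
  fix x :: "'k::field superfun" assume x: "x \<in> aug_ideal m n"
  then have van: "gcoeff x S \<in> vanishing 0" for S
    using coord_alg_subset_order_filtration by (fastforce simp: order_filtration_def aug_ideal_def)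
  have "value_unit (gcoeff x {}) = 0"
    using x by (auto simp: aug_ideal_def counit_eq_value_unit)
  then have "gcoeff x {} \<in> vanishing 1" using van by (intro vanishing_1I)
  then have "gcoeff x S \<in> vanishing (1 - card S)" for S
  proof (cases "S = {} \<or> infinite S")
    case False
    then have "1 - card S = 0" by (simp add: Suc_le_eq card_gt_0_iff)
    then show ?thesis using van[of S] by simp
  qed (use \<open>gcoeff x {} \<in> vanishing 1\<close> in \<open>auto simp: vanishing_0\<close>)
  then show "x \<in> order_filtration 1" by (simp add: order_filtration_def)
qed

lemma aug_power_subset_order_filtration: "aug_power m n t \<subseteq> order_filtration t"
proof (induction t)
  case 0
  show ?case using coord_alg_subset_order_filtration by simp
next
  case (Suc t)
  have "a * b \<in> order_filtration (Suc t)" if "a \<in> aug_ideal m n" "b \<in> aug_power m n t" for a b :: "'a superfun"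
    using that Suc aug_ideal_subset_order_filtration order_filtration_mult[of a 1 b t] by auto
  then have "{a * b | a b. a \<in> aug_ideal m n \<and> b \<in> aug_power m n t} \<subseteq> (order_filtration (Suc t) :: 'a superfun set)"
    by blast
  then show ?case unfolding aug_power.simps by (rule superfun.span_minimal[OF _ order_filtration_subspace])
qed

section \<open>Extension of functionals\<close>

context vector_space
begin

text \<open>Induction on the spanning set. If \<open>span B\<close> meets \<open>J t\<close> only in
  0, then adjoining \<open>b\<close> makes the intersection at most a line; an \<open>s\<close> for
  which \<open>J s\<close> misses a nonzero vector \<open>z\<close> of that line removes the whole
  line.\<close>

lemma finite_span_Int_descending:
  assumes sub: "\<And>k::nat. subspace (J k)" and anti: "\<And>j k. j \<le> k \<Longrightarrow> J k \<subseteq> J j"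
    and zero: "\<And>x. (\<And>k. x \<in> J k) \<Longrightarrow> x = 0" and "finite B"
  shows "\<exists>k. span B \<inter> J k \<subseteq> {0}"
  using \<open>finite B\<close>
proof induction
  case empty
  show ?case by simp
next
  case (insert b B)
  then obtain t where t: "span B \<inter> J t \<subseteq> {0}" by blast
  show ?case
  proof (cases "span (insert b B) \<inter> J t \<subseteq> {0}")
    case False
    then obtain z where z: "z \<in> span (insert b B)" "z \<in> J t" "z \<noteq> 0" by blast
    then obtain s where s: "z \<notin> J s" using zero by blast
    then have "t \<le> s" using anti z(2) by (meson nat_le_linear subsetD)
    from z(1) obtain k where k: "z - scale k b \<in> span B" by (auto simp: span_insert)
    \<comment> \<open>Otherwise \<open>z\<close> would be a nonzero element of \<open>span B\<close>
      and \<open>J t\<close>.\<close>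
    have "k \<noteq> 0" using k z t by auto
    have "y = 0" if y: "y \<in> span (insert b B)" "y \<in> J s" for y
    proof (rule ccontr)
      assume "y \<noteq> 0"
      obtain l where l: "y - scale l b \<in> span B" using y by (auto simp: span_insert)
      \<comment> \<open>The factor \<open>l / k\<close> cancels the multiples of \<open>b\<close>,
        so the difference falls into \<open>span B\<close>.\<close>
      have "y - scale (l / k) z = (y - scale l b) - scale (l / k) (z - scale k b)"
        using \<open>k \<noteq> 0\<close> by (simp add: scale_right_diff_distrib)
      also have "\<dots> \<in> span B" by (intro span_diff[OF l] span_scale[OF k])
      finally have "y - scale (l / k) z \<in> span B" .
      moreover have "y - scale (l / k) z \<in> J t"
        using sub y z anti[OF \<open>t \<le> s\<close>] by (intro subspace_diff subspace_scale) auto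
      ultimately have eq: "y = scale (l / k) z" using t by auto
      then have "l \<noteq> 0" using \<open>y \<noteq> 0\<close> by auto
      then have "z = scale (k / l) y" using eq \<open>k \<noteq> 0\<close> by simp
      then show False using s y sub by (simp add: subspace_scale)
    qed
    then show ?thesis by blast
  qed blast
qed

text \<open>If a new vector \<open>b\<close> were \<open>a + w\<close> with \<open>a\<close> in
  \<open>span A\<close> and \<open>w\<close> in \<open>span B\<close>, then \<open>a = b - w\<close>
  would lie in both spans and be 0, leaving \<open>b\<close> in \<open>span B\<close>.\<close>

lemma independent_Un:
  assumes "independent A" "independent B" "finite B" "span A \<inter> span B \<subseteq> {0}"
  shows "independent (A \<union> B)"
  using assms(3,2,4)
proof (induction B)
  case (insert b B)
  have b: "b \<notin> span B" "independent B" using insert by (auto simp: independent_insert)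
  moreover have "span B \<subseteq> span (insert b B)" by (rule span_mono) auto
  ultimately have ind: "independent (A \<union> B)" using insert by blast
  have "b \<notin> span (A \<union> B)"
  proof
    assume "b \<in> span (A \<union> B)"
    then obtain a w where aw: "b = a + w" "a \<in> span A" "w \<in> span B" by (auto simp: span_Un)
    then have "a = b - w" by simp
    also have "\<dots> \<in> span (insert b B)"
      using aw \<open>span B \<subseteq> span (insert b B)\<close> by (intro span_diff) (auto intro: span_base)
    finally have "a = 0" using aw insert by blast
    then show False using aw b by simp
  qed
  then show ?case using ind by (simp add: independent_insertI)
qed (use assms in simp)

end

text \<open>Prescribe \<open>\<phi>\<close> on a basis of \<open>span B\<close> and 0 on a basis of
  \<open>J\<close>. The trivial intersection makes the union of the two bases independent, so a
  linear map on the ambient space takes these values.\<close>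

lemma extend_functional:
  fixes \<phi> :: "'k::field superfun \<Rightarrow> 'k"
  assumes lin: "linear_on C (*) \<phi>" and C: "superfun.subspace C" and B: "finite B" "B \<subseteq> C"
    and J: "superfun.subspace J" "superfun.span B \<inter> J \<subseteq> {0}"
  obtains g where "Vector_Spaces.linear scal (*) g" "\<And>x. x \<in> J \<Longrightarrow> g x = 0"
    "\<And>x. x \<in> superfun.span B \<Longrightarrow> g x = \<phi> x"
proof -
  interpret pair: vector_space_pair scal "(*) :: 'k \<Rightarrow> 'k \<Rightarrow> 'k"
    by unfold_locales (simp_all add: algebra_simps)
  obtain BD where BD: "BD \<subseteq> B" "superfun.independent BD" "B \<subseteq> superfun.span BD"
    by (rule superfun.maximal_independent_subset)
  obtain BJ where BJ: "BJ \<subseteq> J" "superfun.independent BJ" "J \<subseteq> superfun.span BJ"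
    by (rule superfun.maximal_independent_subset)
  have spans: "superfun.span BD = superfun.span B" "superfun.span BJ = J"
    by (intro equalityI superfun.span_mono superfun.span_minimal superfun.subspace_span BD BJ J(1))+
  have "superfun.independent (BJ \<union> BD)"
    using BD(2) BJ(2) finite_subset[OF BD(1) B(1)] J(2)
    by (intro superfun.independent_Un) (simp_all add: spans Int_commute)
  then obtain g where g: "Vector_Spaces.linear scal (*) g" "\<And>x. x \<in> BJ \<union> BD \<Longrightarrow> g x = (if x \<in> BD then \<phi> x else 0)"
    using pair.linear_independent_extend[of "BJ \<union> BD" "\<lambda>x. if x \<in> BD then \<phi> x else 0"] by blast
  interpret g: Vector_Spaces.linear scal "(*)" g by (rule g(1))
  have disj: "x \<notin> BD" if "x \<in> BJ" for x
  proof
    assume "x \<in> BD"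
    then have "x \<in> superfun.span B" using BD(1) superfun.span_base by blast
    then have "x = 0" using that BJ(1) J(2) by blast
    then show False using \<open>x \<in> BD\<close> BD(2) superfun.dependent_zero by blast
  qed
  have "g x = 0" if "x \<in> J" for x
    using that unfolding spans(2)[symmetric]
  proof (induction rule: superfun.span_induct_alt)
    case (step c x y)
    then show ?case using g(2)[of x] disj[of x] by (simp add: g.add g.scale)
  qed (rule g.zero)
  \<comment> \<open>Membership in \<open>C\<close> is carried through the induction because
    \<open>\<phi>\<close> is linear only there.\<close>
  moreover have "x \<in> C \<and> g x = \<phi> x" if "x \<in> superfun.span B" for x
    using that unfolding spans(1)[symmetric]
  proof (induction rule: superfun.span_induct_alt)
    case base
    have "\<phi> (scal 0 0) = 0 * \<phi> 0"
      using lin superfun.subspace_0[OF C] unfolding linear_on_def by blast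
    then show ?case using superfun.subspace_0[OF C] by (simp add: g.zero)
  next
    case (step c x y)
    have "x \<in> C" using step BD B by blast
    then have "scal c x \<in> C" by (rule superfun.subspace_scale[OF C])
    moreover have "g x = \<phi> x" using g(2)[of x] step by simp
    ultimately show ?case using step lin \<open>x \<in> C\<close>
      by (simp add: linear_on_def g.add g.scale superfun.subspace_add[OF C])
  qed
  ultimately show thesis using g(1) that by blast
qed

section \<open>Density\<close>

lemma coord_alg_subspace: "superfun.subspace (coord_alg m n)"
proof (rule superfun.subspaceI)
  show "0 \<in> coord_alg m n" using coord_alg.const[of 0 m n] by simp
next
  fix c and x :: "'a superfun" assume "x \<in> coord_alg m n"
  then have "scal c 1 * x \<in> coord_alg m n" by (intro coord_alg.mult coord_alg.const)
  then show "scal c x \<in> coord_alg m n" by (simp add: scal_def)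
qed (rule coord_alg.add)

lemma aug_power_subset_coord_alg: "aug_power m n t \<subseteq> (coord_alg m n :: 'k::field superfun set)"
proof (induction t)
  case (Suc t)
  have "a * b \<in> coord_alg m n" if "a \<in> aug_ideal m n" "b \<in> aug_power m n t" for a b :: "'k superfun"
    using that Suc by (intro coord_alg.mult) (auto simp: aug_ideal_def)
  then have "{a * b | a b. a \<in> aug_ideal m n \<and> b \<in> aug_power m n t} \<subseteq> (coord_alg m n :: 'k superfun set)"
    by blast
  then show ?case unfolding aug_power.simps by (rule superfun.span_minimal[OF _ coord_alg_subspace])
qed simp

lemma C_ideal_subset_coord_alg: "C_ideal m n \<Gamma> \<subseteq> coord_alg m n"
  unfolding C_ideal_def
  by (rule superfun.span_minimal[OF _ coord_alg_subspace])
    (auto simp: belongs_to_def subsupermodule_def)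

lemma carrier_Schur: "carrier (Schur m n \<Gamma>) = dual_space (C_ideal m n \<Gamma>)"
  by (simp add: Schur_def functional_superalgebra_def)

lemma C_ideal_subspace: "superfun.subspace (C_ideal m n \<Gamma>)"
  unfolding C_ideal_def by (rule superfun.subspace_span)

lemma pi_map_dual_space:
  assumes "\<xi> \<in> carrier (Dist m n)"
  shows "pi_map m n \<Gamma> \<xi> \<in> dual_space (C_ideal m n \<Gamma>)"
proof -
  have "linear_on (coord_alg m n) (*) \<xi>"
    using assms by (auto simp: Dist_def functional_superalgebra_def dual_space_def)
  then show ?thesis
    by (simp add: dual_space_def pi_map_def linear_on_def C_ideal_subset_coord_alg[THEN subsetD]
      superfun.subspace_add[OF C_ideal_subspace] superfun.subspace_scale[OF C_ideal_subspace])
qed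

text \<open>For large \<open>t\<close> the filtration step \<open>t\<close> meets
  \<open>span B\<close> only in 0, so \<open>\<phi>\<close> on \<open>span B\<close> extends by zero
  on that step; restricting the extension to \<open>coord_alg\<close> gives a distribution.\<close>

lemma pi_map_interpolates:
  fixes \<phi> :: "'k::field superfun \<Rightarrow> 'k"
  assumes \<phi>: "\<phi> \<in> dual_space (C_ideal m n \<Gamma>)" and B: "finite B" "B \<subseteq> C_ideal m n \<Gamma>"
  shows "\<exists>\<xi>\<in>carrier (Dist m n). \<forall>x\<in>superfun.span B. pi_map m n \<Gamma> \<xi> x = \<phi> x"
proof -
  obtain t where t: "superfun.span B \<inter> order_filtration t \<subseteq> {0}"
    using superfun.finite_span_Int_descending[where J = order_filtration, OF order_filtration_subspace
        order_filtration_antimono order_filtration_all_imp_0 B(1)] by blast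
  obtain g where g: "Vector_Spaces.linear scal (*) g" "\<And>x. x \<in> order_filtration t \<Longrightarrow> g x = 0"
    "\<And>x. x \<in> superfun.span B \<Longrightarrow> g x = \<phi> x"
    using \<phi> extend_functional[OF _ C_ideal_subspace B order_filtration_subspace t] unfolding dual_space_def by blast
  interpret g: Vector_Spaces.linear scal "(*)" g by (rule g(1))
  define \<xi> where "\<xi> = restrict g (coord_alg m n)"
  \<comment> \<open>\<open>Dist\<close> asks for vanishing on a power with exponent
    \<open>t + 1\<close>, which lies in filtration step \<open>t + 1\<close> and so in step
    \<open>t\<close>.\<close>
  have "aug_power m n (t + 1) \<subseteq> order_filtration t"
    using aug_power_subset_order_filtration[of m n "t + 1"] order_filtration_antimono[of t "t + 1"] by auto
  then have "\<forall>a\<in>aug_power m n (t + 1). a \<in> coord_alg m n \<longrightarrow> g a = 0" using g(2) by blast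
  \<comment> \<open>\<open>\<xi>\<close> is undefined outside \<open>coord_alg\<close>, so its zeros
    have to be located inside.\<close>
  moreover note aug_power_subset_coord_alg[of m n "t + 1"]
  ultimately have "\<forall>a\<in>aug_power m n (t + 1). \<xi> a = 0"
    unfolding \<xi>_def by auto
  moreover have "\<xi> \<in> dual_space (coord_alg m n)"
    by (simp add: \<xi>_def dual_space_def linear_on_def g.add g.scale
      superfun.subspace_add[OF coord_alg_subspace] superfun.subspace_scale[OF coord_alg_subspace])
  ultimately have "\<xi> \<in> carrier (Dist m n)"
    unfolding Dist_def functional_superalgebra_def by auto
  moreover have "superfun.span B \<subseteq> C_ideal m n \<Gamma>" using B(2) C_ideal_subspace by (rule superfun.span_minimal)
  then have "\<forall>x\<in>superfun.span B. pi_map m n \<Gamma> \<xi> x = \<phi> x"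
    using g(3)
    by (simp add: pi_map_def \<xi>_def subset_iff C_ideal_subset_coord_alg[of m n \<Gamma>, THEN subsetD])
  ultimately show ?thesis by blast
qed

section \<open>Neighbourhoods in the topology of the Schur superalgebra\<close>

lemma openin_subbaseE:
  assumes "openin (topology (arbitrary union_of (finite intersection_of P relative_to S))) T" "x \<in> T"
  obtains F where "finite F" "\<And>U. U \<in> F \<Longrightarrow> P U" "\<And>U. U \<in> F \<Longrightarrow> x \<in> U" "S \<inter> \<Inter>F \<subseteq> T"
proof -
  obtain \<U> where \<U>: "\<U> \<subseteq> Collect (finite intersection_of P relative_to S)" "\<Union>\<U> = T"
    using iffD1[OF openin_subbase assms(1)] unfolding union_of_def by (elim exE conjE)
  then obtain V where V: "V \<in> \<U>" "x \<in> V" using assms(2) by blast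
  then obtain W where W: "(finite intersection_of P) W" "S \<inter> W = V"
    using \<U>(1) unfolding relative_to_def by blast
  obtain F where F: "finite F" "F \<subseteq> Collect P" "\<Inter>F = W"
    using W(1) unfolding intersection_of_def by blast
  show thesis
  proof (rule that)
    show "finite F" "\<And>U. U \<in> F \<Longrightarrow> P U" "\<And>U. U \<in> F \<Longrightarrow> x \<in> U"
      using F V(2) W(2) by blast+
    show "S \<inter> \<Inter>F \<subseteq> T" using F(3) W(2) V(1) \<U>(2) by blast
  qed
qed

text \<open>A subbasic coset containing \<open>\<phi>\<close> is determined by the values of
  \<open>\<phi>\<close> on a finite-dimensional \<open>D\<close>. Finitely many cosets are handled
  by the union of finite spanning sets of their \<open>D\<close>.\<close>

lemma Schur_topology_neighbourhood:
  fixes \<phi> :: "'k::field superfun \<Rightarrow> 'k"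
  assumes T: "openin (Schur_topology m n \<Gamma>) T" "\<phi> \<in> T"
  obtains B where "finite B" "B \<subseteq> C_ideal m n \<Gamma>"
    "\<And>\<psi>. \<psi> \<in> dual_space (C_ideal m n \<Gamma>) \<Longrightarrow> \<forall>x\<in>superfun.span B. \<psi> x = \<phi> x \<Longrightarrow> \<psi> \<in> T"
proof -
  let ?C = "C_ideal m n \<Gamma> :: 'k superfun set"
  let ?P = "\<lambda>U. \<exists>\<phi>\<in>carrier (Schur m n \<Gamma>). \<exists>D. subsupercoalgebra m n D \<and> finite_dim D \<and> D \<subseteq> ?C \<and>
      U = (\<lambda>\<delta>. add (Schur m n \<Gamma>) \<phi> \<delta>) ` perp m n \<Gamma> D"
  obtain F where F: "finite F" "\<And>U. U \<in> F \<Longrightarrow> ?P U" "\<And>U. U \<in> F \<Longrightarrow> \<phi> \<in> U"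
    and sub: "carrier (Schur m n \<Gamma>) \<inter> \<Inter>F \<subseteq> T"
    by (rule openin_subbaseE[OF T(1)[unfolded Schur_topology_def] T(2)]) (rule that)
  have "\<exists>B. finite B \<and> B \<subseteq> ?C \<and> (\<forall>\<psi>\<in>dual_space ?C. (\<forall>x\<in>superfun.span B. \<psi> x = \<phi> x) \<longrightarrow> \<psi> \<in> U)"
    if mem: "U \<in> F" for U
  proof -
    obtain \<phi>' D where \<phi>': "\<phi>' \<in> dual_space ?C" and D: "finite_dim D" "D \<subseteq> ?C"
      and U: "U = (\<lambda>\<delta>. add (Schur m n \<Gamma>) \<phi>' \<delta>) ` perp m n \<Gamma> D"
      using F(2)[OF mem] unfolding carrier_Schur by blast
    obtain B where B: "finite B" "D = superfun.span B" using D(1) unfolding finite_dim_def by blast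
    have add: "add (Schur m n \<Gamma>) a b = (\<lambda>c\<in>?C. a c + b c)" for a b :: "'k superfun \<Rightarrow> 'k"
      by (simp add: Schur_def functional_superalgebra_def)
    have "\<psi> \<in> U" if \<psi>: "\<psi> \<in> dual_space ?C" "\<forall>x\<in>superfun.span B. \<psi> x = \<phi> x" for \<psi>
    proof -
      obtain \<delta> where \<delta>: "\<phi> = (\<lambda>c\<in>?C. \<phi>' c + \<delta> c)" "\<forall>d\<in>D. \<delta> d = 0"
        using F(3)[OF mem] unfolding U add perp_def by blast
      \<comment> \<open>On \<open>D\<close> this is 0, since there \<open>\<psi>\<close> agrees with
        \<open>\<phi>\<close>, which agrees with \<open>\<phi>'\<close>; hence \<open>\<psi>\<close>
        lies in the same coset.\<close>
      define \<delta>' where "\<delta>' = (\<lambda>c\<in>?C. \<psi> c - \<phi>' c)"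
      have "\<delta>' \<in> dual_space ?C"
        using \<psi>(1) \<phi>'
        by (simp add: \<delta>'_def dual_space_def linear_on_def algebra_simps
          superfun.subspace_add[OF C_ideal_subspace] superfun.subspace_scale[OF C_ideal_subspace])
      moreover have "\<delta>' d = 0" if "d \<in> D" for d
      proof -
        have "d \<in> ?C" using that D by blast
        moreover have "\<psi> d = \<phi> d" using that \<psi>(2) B by blast
        ultimately show ?thesis using \<delta> that by (simp add: \<delta>'_def)
      qed
      ultimately have "\<delta>' \<in> perp m n \<Gamma> D" by (simp add: perp_def carrier_Schur)
      moreover have "\<psi> = add (Schur m n \<Gamma>) \<phi>' \<delta>'"
        unfolding add using \<psi>(1)
        by (intro extensionalityI[of _ ?C]) (auto simp: \<delta>'_def dual_space_def)
      ultimately show ?thesis unfolding U by blast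
    qed
    moreover have "B \<subseteq> ?C" using B D superfun.span_superset by blast
    ultimately show ?thesis using B by blast
  qed
  then obtain b where b: "\<And>U. U \<in> F \<Longrightarrow> finite (b U) \<and> b U \<subseteq> ?C \<and>
      (\<forall>\<psi>\<in>dual_space ?C. (\<forall>x\<in>superfun.span (b U). \<psi> x = \<phi> x) \<longrightarrow> \<psi> \<in> U)"
    by metis
  show thesis
  proof (rule that)
    show "finite (\<Union>(b ` F))" "\<Union>(b ` F) \<subseteq> ?C" using F(1) b by auto
    fix \<psi> assume \<psi>: "\<psi> \<in> dual_space ?C" "\<forall>x\<in>superfun.span (\<Union>(b ` F)). \<psi> x = \<phi> x"
    have "\<psi> \<in> U" if "U \<in> F" for U
      using b[OF that] \<psi> superfun.span_mono[of "b U" "\<Union>(b ` F)"] that by blast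
    then show "\<psi> \<in> T" using sub \<psi>(1) by (auto simp: carrier_Schur)
  qed
qed

theorem lemma10p2:
  fixes m n :: nat and \<Gamma> :: "(nat \<Rightarrow> int) set"
  assumes "CHAR('k::field) > 2"
    and "weight_ideal m n \<Gamma>"
  shows "(Schur_topology m n \<Gamma> :: ('k superfun \<Rightarrow> 'k) topology) closure_of
      (pi_map m n \<Gamma> ` carrier (Dist m n)) = carrier (Schur m n \<Gamma>)"
proof
  have top: "topspace (Schur_topology m n \<Gamma> :: ('k superfun \<Rightarrow> 'k) topology) = carrier (Schur m n \<Gamma>)"
    unfolding Schur_topology_def by simp
  show "((Schur_topology m n \<Gamma> :: ('k superfun \<Rightarrow> 'k) topology) closure_of
      (pi_map m n \<Gamma> ` carrier (Dist m n))) \<subseteq> carrier (Schur m n \<Gamma>)"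
    using closure_of_subset_topspace top by metis
  show "carrier (Schur m n \<Gamma>) \<subseteq> ((Schur_topology m n \<Gamma> :: ('k superfun \<Rightarrow> 'k) topology) closure_of
      (pi_map m n \<Gamma> ` carrier (Dist m n)))"
  proof
    fix \<phi> :: "'k superfun \<Rightarrow> 'k" assume \<phi>: "\<phi> \<in> carrier (Schur m n \<Gamma>)"
    \<comment> \<open>Membership in the closure means that every neighbourhood \<open>T\<close> of
      \<open>\<phi>\<close> meets the image; \<open>T\<close> contains all functionals that agree
      with \<open>\<phi>\<close> on a suitable finite-dimensional span, where interpolation is
      exact.\<close>
    have "\<exists>\<xi>\<in>carrier (Dist m n). pi_map m n \<Gamma> \<xi> \<in> T"
      if T: "\<phi> \<in> T" "openin (Schur_topology m n \<Gamma>) T" for T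
    proof -
      obtain B where B: "finite B" "B \<subseteq> C_ideal m n \<Gamma>"
        "\<And>\<psi>. \<psi> \<in> dual_space (C_ideal m n \<Gamma>) \<Longrightarrow> \<forall>x\<in>superfun.span B. \<psi> x = \<phi> x \<Longrightarrow> \<psi> \<in> T"
        by (rule Schur_topology_neighbourhood[OF T(2,1)]) (rule that)
      obtain \<xi> where \<xi>: "\<xi> \<in> carrier (Dist m n)" "\<forall>x\<in>superfun.span B. pi_map m n \<Gamma> \<xi> x = \<phi> x"
        using pi_map_interpolates[OF \<phi>[unfolded carrier_Schur] B(1,2)] by (elim bexE)
      show ?thesis
        using B(3)[OF pi_map_dual_space[OF \<xi>(1)] \<xi>(2)] \<xi>(1) by (rule bexI)
    qed
    then show "\<phi> \<in> Schur_topology m n \<Gamma> closure_of (pi_map m n \<Gamma> ` carrier (Dist m n))"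
      using \<phi> by (auto simp: in_closure_of top)
  qed
qed

end
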